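(* Suppose that $P_0$ is $(0,0,\Omega)$-Euler data whose hypergeometric data has series expansion in $\hbar^{-1}$ of the form $$HG[\mathcal{I}(P_0)](t)=\Omega\Big[1+\sum_{q=1}^\infty\sum_{r=0}^q(-1)^qy^r_{0,q}(t)\,p^{q-r}\hbar^{-q}\Big],$$ where $y^r_{0,q}(t)$ are degree-$r$ symmetric polynomials in $\{\lambda_i\}$. Then $P_0$ may be extended to $(0,1,p,\Omega)$-Euler data $P$ (with height $0$ data $P_0$) in such a way that the hypergeometric data at each height $k$ has series expansion of the form $$HG[\mathcal{I}(P_k)](t)=\Omega p^k\Big[1+\sum_{q=1}^\infty\sum_{r=0}^{q+k}(-1)^qy^r_{k,q}(t)\,p^{q-r}\hbar^{-q}\Big],$$ where $y^r_{k,q}(t)$ are degree-$r$ symmetric polynomials in $\{\lambda_i\}$ and the $y^0_{i,q}(t)$ are recursively given by $$y^0_{i,q}(t)=\frac{{y^0_{i-1,q+1}}'(t)}{{y^0_{i-1,1}}'(t)}\qquad\text{for } i\ge1,\ q\ge1.$$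
   Context: $T=(\mathbb{C}^* )^{n+1}$ with weights $\lambda_0,\dots,\lambda_n$, $\mathcal{R}_T=\mathbb{C}(\lambda_0,\dots,\lambda_n)$; $G=\mathbb{C}^*\times T$, with $\hbar$ the weight of the extra $\mathbb{C}^*$. $\mathcal{R}_TH^*_{(\cdot)}(X)$ denotes equivariant cohomology with nonzero polynomials in the $\lambda_i$ inverted. $T$ acts on $\mathbb{P}^n$ by $[z_0,\dots,z_n]\mapsto[t_0^{-1}z_0,\dots,t_n^{-1}z_n]$, with fixed points $q_0,\dots,q_n$ and equivariant hyperplane class $p$ restricting to $\lambda_i$ at $q_i$. $N_d=\mathbb{P}(H^0(\mathbb{P}^1,\mathcal{O}(d))^{n+1})$ has $G$-action $[\alpha_j(w_0,w_1)]_j\mapsto[t_j^{-1}\alpha_j(t^{-1}w_0,w_1)]_j$. Its fixed points are $p_{i,r}$ ($0\le i\le n$, $0\le r\le d$), having one nonzero ($i$-th) monomial entry, where the equivariant hyperplane class $\kappa$ restricts to $\lambda_i+r\hbar$. For a class $\omega$ on $N_d$, $\omega(\lambda_i+r\hbar)$ denotes its restriction to $p_{i,r}$; for a class on $\mathbb{P}^n$, $\omega(\lambda_i)$ denotes its restriction to $q_i$. $N_0=\mathbb{P}^n$. $\Omega\in\mathcal{R}_TH_T^*(\mathbb{P}^n)$ is invertible. $(0,0,\Omega)$-Euler data is a sequence $Q_d\in\mathcal{R}_TH_G^*(N_d)$, $d\ge0$, with $d=0$ term equal to $\Omega$ and $\Omega(\lambda_i)Q_d(\lambda_i+r\hbar)=Q_r(\lambda_i+r\hbar)Q_{d-r}(\lambda_i)$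 for all $0\le i\le n$, $0\le r\le d$. $(0,1,p,\Omega)$-Euler data is a family $Q_{d,k}\in\mathcal{R}_TH_G^*(N_d)$ ($d,k\ge0$) with $Q_{0,k}=p^k\Omega$ and $\Omega(\lambda_i)Q_{d,k}(\lambda_i+r\hbar)=Q_{r,0}(\lambda_i+r\hbar)Q_{d-r,k}(\lambda_i)$ for all $0\le i\le n$, $0\le r\le d$, $k\ge0$; $Q_k=\{Q_{d,k}\}_d$ is its height $k$ data. $I_d:\mathbb{P}^n\hookrightarrow N_d$, $[a_0,\dots,a_n]\mapsto[a_0w_1^d,\dots,a_nw_1^d]$ (so $I_d^*\kappa=p$). For a sequence $Q=\{Q_d\}$, $\mathcal{I}(Q)=\{I_d^*Q_d\}$ and $$HG[\mathcal{I}(Q)](t)=e^{-pt/\hbar}\sum_{d\ge0}e^{dt}\frac{I_d^*Q_d}{\prod_{l=0}^n\prod_{m=1}^d(p-\lambda_l-m\hbar)}.$$ Convention on expansions: because $p$ satisfies the relation $\prod_l(p-\lambda_l)=0$, the coefficients are understood formally in $p$: at height $k$ ($k=0$ included) one writes $HG[\mathcal{I}(P_k)](t)=\Omega p^ke^{-pt/\hbar}\big(1+\sum_{d\ge1}e^{dt}\sum_{q\ge1}\sum_{r=0}^{q+k}c^r_{d,q}p^{q-r}\hbar^{-q}\big)$ with $c^r_{d,q}$ degree-$r$ symmetric polynomials in $\{\lambda_i\}$ independent of $t$, and the $y^r_{k,q}(t)$ (functions of $t$ through $t$ and power series in $e^t$) are obtained by expanding $e^{-pt/\hbar}$ and collecting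 the coefficients of $p^{q-r}\hbar^{-q}$. A prime denotes $d/dt$. *)

theory Defs
  imports
    "HOL-Library.Poly_Mapping"
    "HOL-Computational_Algebra.Computational_Algebra"
begin

text \<open>
  The finite index type \<open>'n\<close> plays the role of \<open>{0,\<dots>,n}\<close>, so \<open>CARD('n) = n + 1\<close>.
  Its linear order is only used to obtain the integral domain instance of
  the polynomial ring \<open>\<complex>[\<lambda>\<^sub>0,\<dots>,\<lambda>\<^sub>n]\<close>.
\<close>

type_synonym 'n mpoly = "('n \<Rightarrow>\<^sub>0 nat) \<Rightarrow>\<^sub>0 complex"

type_synonym 'n RT = "'n mpoly fract"

definition mconst :: "complex \<Rightarrow> 'n mpoly" where
  "mconst a = Poly_Mapping.single 0 a"

definition to_RT :: "'n::linorder mpoly \<Rightarrow> 'n RT" where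
  "to_RT f = Fract f 1"

definition lam :: "'n::linorder \<Rightarrow> 'n RT" where
  "lam i = to_RT (Poly_Mapping.single (Poly_Mapping.single i 1) 1)"

text \<open>Homogeneous of degree \<open>r\<close> and invariant under all permutations of the variables.\<close>

definition symmetric_of_degree :: "nat \<Rightarrow> ('n::finite) mpoly \<Rightarrow> bool" where
  "symmetric_of_degree r f \<longleftrightarrow>
     (\<forall>m \<in> Poly_Mapping.keys f. (\<Sum>i\<in>UNIV. Poly_Mapping.lookup m i) = r) \<and>
     (\<forall>\<pi>::'n \<Rightarrow> 'n. bij \<pi> \<longrightarrow>
        (\<forall>m. Poly_Mapping.lookup f (Poly_Mapping.map_key \<pi> m) = Poly_Mapping.lookup f m))"


subsection \<open>Equivariant cohomology\<close>

text \<open>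
  The localised equivariant cohomology rings are taken in their standard presentations
  \<open>\<R>\<^sub>T H\<^sub>T(\<P>\<^sup>n) = \<R>\<^sub>T[p] / \<Prod>\<^sub>i (p - \<lambda>\<^sub>i)\<close> and
  \<open>\<R>\<^sub>T H\<^sub>G(N\<^sub>d) = \<R>\<^sub>T[\<hbar>][\<kappa>] / \<Prod>\<^sub>i \<Prod>\<^sub>r\<^sub>\<le>\<^sub>d (\<kappa> - \<lambda>\<^sub>i - r\<hbar>)\<close>.
  A class is given by a polynomial representative, and equality of classes is congruence modulo
  the relation. A class on \<open>\<P>\<^sup>n\<close> has type \<open>'n RT poly\<close> (variable \<open>p\<close>); a class on
  \<open>N\<^sub>d\<close> has type \<open>'n RT poly poly\<close> (outer variable \<open>\<kappa>\<close>, inner variable \<open>\<hbar>\<close>).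
  Restriction to a fixed point is evaluation of the representative at the weight there:
  \<open>\<omega>(\<lambda>\<^sub>i + r\<hbar>)\<close> is \<^term>\<open>poly \<omega> (weight i r)\<close>.
\<close>

definition weight :: "'n::linorder \<Rightarrow> nat \<Rightarrow> 'n RT poly" where
  "weight i r = [:lam i, of_nat r:]"

definition rel_P :: "('n::{finite,linorder}) RT poly" where
  "rel_P = (\<Prod>i\<in>UNIV. [:- lam i, 1:])"

definition rel_N :: "nat \<Rightarrow> ('n::{finite,linorder}) RT poly poly" where
  "rel_N d = (\<Prod>i\<in>UNIV. \<Prod>r\<le>d. [:- weight i r, 1:])"

definition eq_P :: "('n::{finite,linorder}) RT poly \<Rightarrow> 'n RT poly \<Rightarrow> bool" where
  "eq_P f g \<longleftrightarrow> rel_P dvd f - g"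

definition eq_N :: "nat \<Rightarrow> ('n::{finite,linorder}) RT poly poly \<Rightarrow> 'n RT poly poly \<Rightarrow> bool" where
  "eq_N d f g \<longleftrightarrow> rel_N d dvd f - g"

lemma eq_N_restrict:
  assumes "eq_N d f g" "r \<le> d"
  shows "poly f (weight i r) = poly g (weight i r)"
proof -
  have "poly (rel_N d) (weight i r) = 0"
    unfolding rel_N_def poly_prod using assms(2)
    by (intro prod_zero bexI[of _ i]) (auto intro!: prod_zero bexI[of _ r])
  moreover from assms(1) obtain h where "f - g = rel_N d * h"
    unfolding eq_N_def by (auto elim: dvdE)
  ultimately have "poly (f - g) (weight i r) = 0" by simp
  then show ?thesis by simp
qed

lemma of_nat_RT: "(of_nat m :: 'n::linorder RT) = to_RT (of_nat m)"
  by (induction m) (simp_all add: to_RT_def Zero_fract_def One_fract_def)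

lemma to_RT_eq_iff: "to_RT f = to_RT g \<longleftrightarrow> f = g"
  by (simp add: to_RT_def eq_fract)

lemma of_nat_RT_eq_iff: "(of_nat m :: 'n::linorder RT) = of_nat m' \<longleftrightarrow> m = m'"
  by (simp add: of_nat_RT to_RT_eq_iff)

lemma lam_eq_iff: "lam i = lam j \<longleftrightarrow> i = j"
proof
  assume "lam i = lam j"
  then have "Poly_Mapping.single (Poly_Mapping.single i (1::nat)) (1::complex) =
      Poly_Mapping.single (Poly_Mapping.single j 1) 1"
    by (simp add: lam_def to_RT_eq_iff)
  then have "Poly_Mapping.keys (Poly_Mapping.single (Poly_Mapping.single i (1::nat)) (1::complex)) =
      Poly_Mapping.keys (Poly_Mapping.single (Poly_Mapping.single j (1::nat)) (1::complex))"
    by simp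
  then have "Poly_Mapping.single i (1::nat) = Poly_Mapping.single j 1"
    by simp
  then have "Poly_Mapping.keys (Poly_Mapping.single i (1::nat)) =
      Poly_Mapping.keys (Poly_Mapping.single j (1::nat))"
    by simp
  then show "i = j" by simp
qed simp

lemma weight_eq_iff: "weight i r = weight j s \<longleftrightarrow> i = j \<and> r = s"
  by (simp add: weight_def lam_eq_iff of_nat_RT_eq_iff)

lemma prod_linear_dvd:
  fixes f :: "'a::idom poly"
  assumes "finite S" "\<And>a. a \<in> S \<Longrightarrow> poly f a = 0"
  shows "(\<Prod>a\<in>S. [:- a, 1:]) dvd f"
  using assms
proof (induction S arbitrary: f rule: finite_induct)
  case (insert a S)
  from insert.prems[of a] obtain h where h: "f = [:- a, 1:] * h"
    by (auto simp: poly_eq_0_iff_dvd elim: dvdE)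
  have "poly h b = 0" if "b \<in> S" for b
    using insert.prems[of b] insert.hyps that by (auto simp: h)
  then have "(\<Prod>a\<in>S. [:- a, 1:]) dvd h" by (rule insert.IH)
  then show ?case
    unfolding h prod.insert[OF insert.hyps] by (rule mult_dvd_mono[OF dvd_refl])
qed simp

text \<open>A class on \<open>N\<^sub>d\<close> is determined by its restrictions to the fixed points.\<close>

lemma eq_N_iff:
  "eq_N d f g \<longleftrightarrow> (\<forall>i. \<forall>r\<le>d. poly f (weight i r) = poly g (weight i r))"
proof
  assume R: "\<forall>i. \<forall>r\<le>d. poly f (weight i r) = poly g (weight i r)"
  let ?S = "(\<lambda>(i, r). weight i r) ` (UNIV \<times> {..d})"
  have "rel_N d = (\<Prod>(i, r)\<in>UNIV \<times> {..d}. [:- weight i r, 1:])"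
    by (simp add: rel_N_def prod.cartesian_product)
  also have "\<dots> = (\<Prod>a\<in>?S. [:- a, 1:])"
    by (subst prod.reindex) (auto simp: inj_on_def weight_eq_iff split_def)
  also have "\<dots> dvd f - g"
    using R by (intro prod_linear_dvd) auto
  finally show "eq_N d f g" by (simp add: eq_N_def)
qed (auto intro: eq_N_restrict)

definition invertible_class :: "('n::{finite,linorder}) RT poly \<Rightarrow> bool" where
  "invertible_class \<Omega> \<longleftrightarrow> (\<exists>\<Omega>'. eq_P (\<Omega> * \<Omega>') 1)"

text \<open>The map \<open>\<R>\<^sub>T H\<^sub>T(\<P>\<^sup>n) \<rightarrow> \<R>\<^sub>T H\<^sub>G(\<P>\<^sup>n) = \<R>\<^sub>T H\<^sub>G(N\<^sub>0)\<close>.\<close>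

definition to_N0 :: "'n::linorder RT poly \<Rightarrow> 'n RT poly poly" where
  "to_N0 = map_poly (\<lambda>a. [:a:])"


subsection \<open>Euler data\<close>

definition euler_data ::
  "('n::{finite,linorder}) RT poly \<Rightarrow> (nat \<Rightarrow> 'n RT poly poly) \<Rightarrow> bool" where
  "euler_data \<Omega> Q \<longleftrightarrow>
     eq_N 0 (Q 0) (to_N0 \<Omega>) \<and>
     (\<forall>i d r. r \<le> d \<longrightarrow>
        [:poly \<Omega> (lam i):] * poly (Q d) (weight i r) =
        poly (Q r) (weight i r) * poly (Q (d - r)) (weight i 0))"

text \<open>\<open>(0,1,p,\<Omega>)\<close>-Euler data; \<open>Q d k\<close> is \<open>Q\<^sub>d\<^sub>,\<^sub>k\<close>.\<close>

definition linked_euler_data ::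
  "('n::{finite,linorder}) RT poly \<Rightarrow> (nat \<Rightarrow> nat \<Rightarrow> 'n RT poly poly) \<Rightarrow> bool" where
  "linked_euler_data \<Omega> Q \<longleftrightarrow>
     (\<forall>k. eq_N 0 (Q 0 k) ([:0, 1:] ^ k * to_N0 \<Omega>)) \<and>
     (\<forall>i d r k. r \<le> d \<longrightarrow>
        [:poly \<Omega> (lam i):] * poly (Q d k) (weight i r) =
        poly (Q r 0) (weight i r) * poly (Q (d - r) k) (weight i 0))"


subsection \<open>Hypergeometric data\<close>

text \<open>
  With \<open>x = e\<^sup>t\<close> as a formal variable, hypergeometric data live in
  \<open>\<R>\<^sub>T[p][t]((\<hbar>\<^sup>-\<^sup>1))[[x]]\<close>, modulo \<open>\<Prod>\<^sub>i (p - \<lambda>\<^sub>i)\<close> coefficientwise.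
  The Laurent variable \<^term>\<open>fls_X\<close> is \<open>\<hbar>\<^sup>-\<^sup>1\<close>, so \<open>\<hbar>\<close> is \<^term>\<open>fls_X_inv\<close>.
\<close>

type_synonym 'n laurent = "'n RT poly poly fls"

definition eq_HG ::
  "('n::{finite,linorder}) laurent fps \<Rightarrow> 'n laurent fps \<Rightarrow> bool" where
  "eq_HG F G \<longleftrightarrow>
     (\<forall>d z a. eq_P (coeff (fls_nth (fps_nth F d) z) a) (coeff (fls_nth (fps_nth G d) z) a))"

text \<open>
  The expansion in \<open>\<hbar>\<^sup>-\<^sup>1\<close> of the pullback \<open>I\<^sub>d\<^sup>*\<close>: since \<open>I\<^sub>d\<^sup>* \<kappa> = p\<close>, on
  representatives it is the substitution \<open>\<kappa> := p\<close>.
\<close>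

definition pullback :: "('n::linorder) RT poly poly \<Rightarrow> 'n laurent" where
  "pullback f =
     poly (map_poly (\<lambda>g. poly (map_poly (\<lambda>a. fls_const [:[:a:]:]) g) fls_X_inv) f)
          (fls_const [:[:0, 1:]:])"

text \<open>
  The inverse of \<open>p - \<lambda>\<^sub>l - m\<hbar>\<close> for \<open>m \<ge> 1\<close>, that is
  \<open>- \<Sum>\<^sub>j (p - \<lambda>\<^sub>l)\<^sup>j (m\<hbar>)\<^sup>-\<^sup>j\<^sup>-\<^sup>1\<close>; see \<open>inv_factor\<close> below.
\<close>

definition inv_factor :: "'n::linorder \<Rightarrow> nat \<Rightarrow> 'n laurent" where
  "inv_factor l m = fps_to_fls (Abs_fps (\<lambda>q. case q of
       0 \<Rightarrow> 0
     | Suc j \<Rightarrow> [:- smult (inverse (of_nat m ^ Suc j)) ([:- lam l, 1:] ^ j):]))"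

lemma pullback_linear:
  "pullback [:- weight l m, 1:] = fls_const [:[:- lam l, 1:]:] - of_nat m * fls_X_inv"
proof -
  have "pullback [:- weight l m, 1:] =
      fls_const [:[:- lam l:]:] + fls_X_inv * fls_const [:[:- of_nat m:]:] + fls_const [:[:0, 1:]:]"
    by (simp add: pullback_def weight_def map_poly_pCons map_poly_1' flip: one_pCons)
  also have "fls_const [:[:- of_nat m:]:] = - (of_nat m :: 'a laurent)"
    unfolding fls_of_nat of_nat_poly fls_const_uminus[symmetric] by simp
  also have "fls_const [:[:0, 1:]:] = fls_const [:[:- lam l, 1:]:] - fls_const [:[:- lam l:]:]"
    unfolding fls_minus_const by simp
  also have "a + b + (c - a) = c + b" for a b c :: "'a laurent"
    by simp
  finally show ?thesis
    by (simp only: diff_conv_add_uminus mult_minus_right mult.commute[of fls_X_inv])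
qed

lemma inv_factor:
  assumes "m \<ge> 1"
  shows "pullback [:- weight l m, 1:] * inv_factor l m = 1"
proof (rule fls_eqI)
  fix z :: int
  let ?u = "[:- lam l, 1:]" and ?m = "of_nat m :: 'a RT"
  have m0: "?m \<noteq> 0"
    using assms of_nat_RT_eq_iff[of m 0] by simp
  have nth: "fls_nth (pullback [:- weight l m, 1:] * inv_factor l m) z =
      [:?u:] * fls_nth (inv_factor l m) z - of_nat m * fls_nth (inv_factor l m) (z + 1)"
    by (simp only: pullback_linear left_diff_distrib mult.assoc[of "of_nat m"]
        fls_X_inv_times_conv_shift(1)[of "inv_factor l m"]
        fls_minus_nth fls_mult_of_nat_nth fls_shift_nth fls_mult_const_nth)
  consider "z < 0" | "z = 0" | j where "z = int (Suc j)"
    by (cases z rule: int_cases3) (auto simp: gr0_conv_Suc)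
  then show "fls_nth (pullback [:- weight l m, 1:] * inv_factor l m) z = fls_nth 1 z"
  proof cases
    case 1
    then show ?thesis unfolding nth by (auto simp: inv_factor_def)
  next
    case 2
    then show ?thesis unfolding nth using m0
      by (simp add: inv_factor_def of_nat_poly one_pCons)
  next
    case 3
    have e: "int (Suc j) + 1 = int (Suc (Suc j))" by simp
    have F: "fls_nth (inv_factor l m) (int (Suc i)) =
        [:- smult (inverse (?m ^ Suc i)) (?u ^ i):]" for i
      unfolding inv_factor_def fps_to_fls_nth by (simp del: power_Suc of_nat_Suc)
    have "?m * inverse (?m ^ Suc (Suc j)) = inverse (?m ^ Suc j)"
      using m0 by simp
    moreover have "of_nat m * [:- smult a v:] = [:- smult (?m * a) v:]" for a v
      by (simp add: of_nat_poly)
    moreover have "[:u:] * [:- smult a (u ^ j):] = [:- smult a (u ^ Suc j):]"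
      for a and u :: "'a RT poly"
      by (simp add: mult.commute)
    ultimately have "fls_nth (pullback [:- weight l m, 1:] * inv_factor l m) (int (Suc j)) = 0"
      unfolding nth[unfolded 3 e] F by (simp only: diff_self)
    then show ?thesis unfolding 3 by simp
  qed
qed

text \<open>\<open>e\<^sup>-\<^sup>p\<^sup>t\<^sup>/\<^sup>\<hbar>\<close>; the inner monomial is in \<open>p\<close>, the outer one in \<open>t\<close>.\<close>

definition exp_pt :: "('n::linorder) laurent" where
  "exp_pt = fps_to_fls (Abs_fps (\<lambda>m. monom (monom (to_RT (mconst ((-1) ^ m / fact m))) m) m))"

definition HG :: "(nat \<Rightarrow> ('n::{finite,linorder}) RT poly poly) \<Rightarrow> 'n laurent fps" where
  "HG Q = fps_const exp_pt *
     Abs_fps (\<lambda>d. pullback (Q d) * (\<Prod>l\<in>UNIV. \<Prod>m=1..d. inv_factor l m))"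


subsection \<open>Series expansions\<close>

text \<open>
  Functions of \<open>t\<close> built from \<open>t\<close> and power series in \<open>e\<^sup>t\<close>, with coefficients in
  \<open>\<complex>[\<lambda>\<^sub>0,\<dots>,\<lambda>\<^sub>n]\<close>, are elements of \<open>\<complex>[\<lambda>][t][[x]]\<close>; \<open>ddt\<close> is \<open>d/dt\<close> there.
\<close>

type_synonym 'n tfun = "'n mpoly poly fps"

definition ddt :: "('n::linorder) tfun \<Rightarrow> 'n tfun" where
  "ddt f = Abs_fps (\<lambda>d. pderiv (fps_nth f d) + of_nat d * fps_nth f d)"

text \<open>
  \<open>\<Omega> p\<^sup>k (1 + \<Sum>\<^sub>d \<Sum>\<^sub>q\<^sub>\<ge>\<^sub>1 \<Sum>\<^sub>r\<^sub>\<le>\<^sub>q\<^sub>+\<^sub>k x\<^sup>d A\<^sub>d\<^sub>,\<^sub>q\<^sub>,\<^sub>r(t) p\<^sup>q\<^sup>-\<^sup>r \<hbar>\<^sup>-\<^sup>q)\<close>.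
  The exponent \<open>k + q - r\<close> of \<open>p\<close> is non-negative throughout.
\<close>

definition hseries ::
  "nat \<Rightarrow> ('n::{finite,linorder}) RT poly \<Rightarrow> (nat \<Rightarrow> nat \<Rightarrow> nat \<Rightarrow> 'n mpoly poly) \<Rightarrow> 'n laurent fps"
where
  "hseries k \<Omega> A = Abs_fps (\<lambda>d. fps_to_fls (Abs_fps (\<lambda>q.
     if q = 0 then (if d = 0 then [:\<Omega> * [:0, 1:] ^ k:] else 0)
     else (\<Sum>r\<le>q + k. map_poly (\<lambda>a. [:to_RT a:]) (A d q r) * [:\<Omega> * [:0, 1:] ^ (k + q - r):]))))"

text \<open>
  The coefficient of \<open>p\<^sup>q\<^sup>-\<^sup>r \<hbar>\<^sup>-\<^sup>q\<close>, formally in \<open>p\<close>, of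
  \<open>e\<^sup>-\<^sup>p\<^sup>t\<^sup>/\<^sup>\<hbar> (1 + \<Sum>\<^sub>d\<^sub>\<ge>\<^sub>1 x\<^sup>d \<Sum>\<^sub>q\<^sub>\<ge>\<^sub>1 \<Sum>\<^sub>r\<^sub>\<le>\<^sub>q\<^sub>+\<^sub>k c\<^sub>d\<^sub>,\<^sub>q\<^sub>,\<^sub>r p\<^sup>q\<^sup>-\<^sup>r \<hbar>\<^sup>-\<^sup>q)\<close>:
  the term \<open>(-t)\<^sup>m/m! p\<^sup>m \<hbar>\<^sup>-\<^sup>m\<close> of the exponential is paired with \<open>c\<^sub>d\<^sub>,\<^sub>q\<^sub>-\<^sub>m\<^sub>,\<^sub>r\<close>.
\<close>

definition collect ::
  "nat \<Rightarrow> (nat \<Rightarrow> nat \<Rightarrow> nat \<Rightarrow> ('n::linorder) mpoly) \<Rightarrow> nat \<Rightarrow> nat \<Rightarrow> 'n tfun" where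
  "collect k c q r = Abs_fps (\<lambda>d.
     if d = 0 then (if r = 0 then monom (mconst ((-1) ^ q / fact q)) q else 0)
     else (\<Sum>m | m < q \<and> r \<le> q - m + k.
             monom (mconst ((-1) ^ m / fact m) * c d (q - m) r) m))"

text \<open>
  Height \<open>k\<close> data \<open>Q\<close> have an expansion with coefficients \<open>y q r\<close> (for \<open>y\<^sup>r\<^sub>k\<^sub>,\<^sub>q\<close>).
  Since \<open>p\<close> satisfies a relation, the \<open>y q r\<close> are not determined by the hypergeometric data;
  they are required to come from \<open>t\<close>-independent coefficients \<open>c d q r\<close>
  (for \<open>c\<^sup>r\<^sub>d\<^sub>,\<^sub>q\<close>) by expanding \<open>e\<^sup>-\<^sup>p\<^sup>t\<^sup>/\<^sup>\<hbar>\<close> formally in \<open>p\<close>.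
\<close>

definition has_expansion ::
  "nat \<Rightarrow> ('n::{finite,linorder}) RT poly \<Rightarrow> (nat \<Rightarrow> 'n RT poly poly) \<Rightarrow>
   (nat \<Rightarrow> nat \<Rightarrow> 'n tfun) \<Rightarrow> bool" where
  "has_expansion k \<Omega> Q y \<longleftrightarrow>
     (\<forall>q\<ge>1. \<forall>r\<le>q + k. \<forall>d a. symmetric_of_degree r (coeff (fps_nth (y q r) d) a)) \<and>
     eq_HG (HG Q) (hseries k \<Omega> (\<lambda>d q r. (-1) ^ q * fps_nth (y q r) d)) \<and>
     (\<exists>c. (\<forall>d\<ge>1. \<forall>q\<ge>1. \<forall>r\<le>q + k. symmetric_of_degree r (c d q r)) \<and>
          eq_HG (HG Q)
            (fps_const exp_pt * hseries k \<Omega> (\<lambda>d q r. if d = 0 then 0 else [:c d q r:])) \<and>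
          (\<forall>q\<ge>1. \<forall>r\<le>q + k. (-1) ^ q * y q r = collect k c q r))"

end

theory Submission
  imports Defs
begin

text \<open>
  Strip the unit \<open>e\<^sup>-\<^sup>p\<^sup>t\<^sup>/\<^sup>\<hbar>\<close> from the hypergeometric data, so that \<open>\<hbar> d/dt\<close> becomes
  \<open>\<hbar>\<theta> - p\<close> with \<open>\<theta> = x d/dx\<close>. On Euler data two operations preserve linkage to height \<open>0\<close>:
  multiplication of the degree \<open>d\<close> term by \<open>\<kappa> - d\<hbar>\<close>, which induces \<open>p - \<hbar>\<theta>\<close>, and multiplication
  of the hypergeometric data by a power series in \<open>x\<close> over \<open>\<complex>[\<lambda>]\<close>. Applying \<open>p - \<hbar>\<theta>\<close> to the
  data of height \<open>k\<close> gives \<open>g\<^sub>0 p\<^sup>k\<^sup>+\<^sup>1 + g\<^sub>1 p\<^sup>k + \<dots> + g\<^sub>k\<^sub>+\<^sub>1\<close> (times \<open>\<Omega>\<close>) in order \<open>\<hbar>\<^sup>0\<close>, where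
  \<open>g\<^sub>j\<close> is a series in \<open>x\<close> with coefficients of degree \<open>j\<close> in \<open>\<lambda>\<close> and \<open>g\<^sub>0\<close> has constant term \<open>1\<close>.
  Subtracting \<open>g\<^sub>j\<close> times the data of height \<open>k + 1 - j\<close> for \<open>j \<ge> 1\<close> and dividing by
  \<open>g\<^sub>0 = y\<^sup>0\<^sub>k\<^sub>,\<^sub>1'\<close> yields the data of height \<open>k + 1\<close>; the subtracted terms have positive degree in
  \<open>\<lambda>\<close>, so the recursion for \<open>y\<^sup>0\<close> only sees the derivative and the division.
\<close>



section \<open>Ring homomorphisms\<close>

text \<open>The coefficient changes below (\<open>to_RT\<close>, constant embeddings,
  \<open>pullback\<close>, \<open>emb_laurent\<close>, \<open>lift_t\<close>) are all instances, so
  sums, products and naturals are pushed through them uniformly.\<close>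

locale ring_map =
  fixes h :: "'a::comm_ring_1 \<Rightarrow> 'b::comm_ring_1"
  assumes map_add: "h (a + b) = h a + h b"
    and map_mult: "h (a * b) = h a * h b"
    and map_one: "h 1 = 1"
begin

lemma map_zero: "h 0 = 0"
  using map_add[of 0 0] by simp

lemma map_uminus: "h (- a) = - h a"
  using map_add[of a "- a"] by (simp add: map_zero add_eq_0_iff)

lemma map_diff: "h (a - b) = h a - h b"
  using map_add[of a "- b"] by (simp add: map_uminus)

lemma map_sum: "h (\<Sum>x\<in>S. f x) = (\<Sum>x\<in>S. h (f x))"
  by (induction S rule: infinite_finite_induct) (simp_all add: map_zero map_add)

lemma map_prod: "h (\<Prod>x\<in>S. f x) = (\<Prod>x\<in>S. h (f x))"
  by (induction S rule: infinite_finite_induct) (simp_all add: map_one map_mult)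

lemma map_of_nat: "h (of_nat n) = of_nat n"
  by (induction n) (simp_all add: map_zero map_one map_add)

lemmas map_simps = map_zero map_one map_add map_mult map_uminus map_diff map_sum map_prod map_of_nat

end

lemma ring_map_comp:
  assumes "ring_map g" "ring_map h"
  shows "ring_map (\<lambda>a. g (h a))"
proof -
  interpret g: ring_map g by fact
  interpret h: ring_map h by fact
  show ?thesis by unfold_locales (simp_all add: g.map_simps h.map_simps)
qed

lemma ring_map_const_poly: "ring_map (\<lambda>a::'a::comm_ring_1. [:a:])"
  by unfold_locales (simp_all add: one_pCons)

lemma ring_map_fls_const: "ring_map (fls_const :: 'a::comm_ring_1 \<Rightarrow> _)"
  by unfold_locales (simp_all add: fls_plus_const)

lemma ring_map_poly: "ring_map (\<lambda>p. poly p (x::'a::comm_ring_1))"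
  by unfold_locales simp_all

lemma ring_map_map_poly:
  assumes "ring_map h"
  shows "ring_map (map_poly h)"
proof -
  interpret ring_map h by fact
  show ?thesis
    by unfold_locales
      (simp_all add: poly_eq_iff coeff_map_poly coeff_mult map_simps)
qed

lemma ring_map_fps:
  assumes "ring_map h"
  shows "ring_map (\<lambda>f. Abs_fps (\<lambda>d. h (fps_nth f d)))"
proof -
  interpret ring_map h by fact
  show ?thesis
    by unfold_locales (simp_all add: fps_eq_iff fps_mult_nth map_simps)
qed

lemma ring_map_to_RT: "ring_map (to_RT :: 'n::linorder mpoly \<Rightarrow> _)"
  by unfold_locales (simp_all add: to_RT_def One_fract_def)


section \<open>Symmetric polynomials\<close>

lemma symmetric_of_degree_0 [simp]: "symmetric_of_degree r 0"
  by (simp add: symmetric_of_degree_def)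

lemma symmetric_of_degree_add:
  assumes "symmetric_of_degree r f" "symmetric_of_degree r g"
  shows "symmetric_of_degree r (f + g)"
  using assms keys_add[of f g] unfolding symmetric_of_degree_def
  by (auto simp: lookup_add)

lemma symmetric_of_degree_uminus:
  assumes "symmetric_of_degree r f"
  shows "symmetric_of_degree r (- f)"
  using assms unfolding symmetric_of_degree_def by simp

lemma symmetric_of_degree_diff:
  assumes "symmetric_of_degree r f" "symmetric_of_degree r g"
  shows "symmetric_of_degree r (f - g)"
  using symmetric_of_degree_add[OF assms(1) symmetric_of_degree_uminus[OF assms(2)]] by simp

lemma symmetric_of_degree_sum:
  assumes "\<And>x. x \<in> S \<Longrightarrow> symmetric_of_degree r (f x)"
  shows "symmetric_of_degree r (\<Sum>x\<in>S. f x)"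
  using assms by (induction S rule: infinite_finite_induct) (auto intro: symmetric_of_degree_add)

text \<open>The inverse is \<open>Poly_Mapping.map_key (inv \<pi>)\<close>. This allows sums over
  monomials to be reindexed by a permutation of the variables.\<close>

lemma bij_map_key:
  fixes \<pi> :: "'a \<Rightarrow> 'b"
  assumes "bij \<pi>"
  shows "bij (Poly_Mapping.map_key \<pi> :: ('b \<Rightarrow>\<^sub>0 'c::zero) \<Rightarrow> _)"
proof (rule o_bij)
  from assms have i: "inj \<pi>" "inj (inv \<pi>)"
    by (auto simp: bij_is_inj bij_imp_bij_inv)
  have "\<pi> \<circ> inv \<pi> = (\<lambda>x. x)" "inv \<pi> \<circ> \<pi> = (\<lambda>x. x)"
    using assms by (auto simp: bij_is_surj surj_f_inv_f bij_is_inj fun_eq_iff)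
  then have "Poly_Mapping.map_key (inv \<pi>) (Poly_Mapping.map_key \<pi> m) = m"
      "Poly_Mapping.map_key \<pi> (Poly_Mapping.map_key (inv \<pi>) m') = m'"
    for m :: "'b \<Rightarrow>\<^sub>0 'c" and m' :: "'a \<Rightarrow>\<^sub>0 'c"
    by (simp_all only: map_key_compose[OF i] map_key_compose[OF i(2,1)] map_key_id)
  then show "Poly_Mapping.map_key (inv \<pi>) \<circ> Poly_Mapping.map_key \<pi> = (id :: ('b \<Rightarrow>\<^sub>0 'c) \<Rightarrow> _)"
    and "Poly_Mapping.map_key \<pi> \<circ> Poly_Mapping.map_key (inv \<pi>) = (id :: ('a \<Rightarrow>\<^sub>0 'c) \<Rightarrow> _)"
    by (simp_all add: fun_eq_iff)
qed

text \<open>A permutation acts on monomials bijectively and additively, so reindexing both sums of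
  the convolution moves it onto the factors.\<close>

lemma symmetric_of_degree_mult:
  fixes f g :: "'n::finite mpoly"
  assumes "symmetric_of_degree r f" "symmetric_of_degree s g"
  shows "symmetric_of_degree (r + s) (f * g)"
  unfolding symmetric_of_degree_def
proof (intro conjI allI impI ballI)
  fix m assume "m \<in> Poly_Mapping.keys (f * g)"
  with keys_mult[of f g] obtain a b where "m = a + b" "a \<in> Poly_Mapping.keys f" "b \<in> Poly_Mapping.keys g"
    by auto
  then show "(\<Sum>i\<in>UNIV. Poly_Mapping.lookup m i) = r + s"
    using assms by (simp add: symmetric_of_degree_def lookup_add sum.distrib)
next
  fix \<pi> :: "'n \<Rightarrow> 'n" and m
  assume b: "bij \<pi>"
  let ?k = "Poly_Mapping.map_key \<pi> :: ('n \<Rightarrow>\<^sub>0 nat) \<Rightarrow> _"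
  have bk: "bij ?k" using b by (rule bij_map_key)
  have kp: "?k (a + c) = ?k a + ?k c" for a c
    using b by (simp add: map_key_plus bij_is_inj)
  have kf: "Poly_Mapping.lookup f (?k a) = Poly_Mapping.lookup f a"
    and kg: "Poly_Mapping.lookup g (?k a) = Poly_Mapping.lookup g a" for a
    using assms b by (simp_all add: symmetric_of_degree_def)
  have "Poly_Mapping.lookup (f * g) (?k m) =
      (\<Sum>l. Poly_Mapping.lookup f l * (\<Sum>q. Poly_Mapping.lookup g q when ?k m = l + q))"
    by (simp add: lookup_mult)
  also have "\<dots> = (\<Sum>l. Poly_Mapping.lookup f (?k l) *
      (\<Sum>q. Poly_Mapping.lookup g q when ?k m = ?k l + q))"
    by (rule Sum_any.reindex_cong[OF bk]) (simp add: fun_eq_iff)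
  also have "(\<lambda>l. \<Sum>q. Poly_Mapping.lookup g q when ?k m = ?k l + q) =
      (\<lambda>l. \<Sum>q. Poly_Mapping.lookup g (?k q) when ?k m = ?k l + ?k q)"
    by (rule ext, rule Sum_any.reindex_cong[OF bk]) (simp add: fun_eq_iff)
  also have "(\<Sum>l. Poly_Mapping.lookup f (?k l) *
        (\<Sum>q. Poly_Mapping.lookup g (?k q) when ?k m = ?k l + ?k q)) =
      Poly_Mapping.lookup (f * g) m"
    using bk by (simp add: lookup_mult kf kg flip: kp add: bij_is_inj inj_eq)
  finally show "Poly_Mapping.lookup (f * g) (?k m) = Poly_Mapping.lookup (f * g) m" .
qed

lemma symmetric_of_degree_mconst: "symmetric_of_degree 0 (mconst a)"
proof -
  have "Poly_Mapping.map_key \<pi> m = 0 \<longleftrightarrow> m = 0" if "bij \<pi>" for \<pi> :: "'a \<Rightarrow> 'a" and m :: "'a \<Rightarrow>\<^sub>0 nat"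
    using that bij_map_key[OF that] by (metis bij_is_inj inj_eq map_key_zero)
  then show ?thesis
    by (auto simp: symmetric_of_degree_def mconst_def lookup_single when_def split: if_splits)
qed

lemma mconst_1: "mconst 1 = 1"
  by (simp add: mconst_def)

lemma symmetric_of_degree_of_nat_mult:
  assumes "symmetric_of_degree r f"
  shows "symmetric_of_degree r (of_nat d * f)"
  using assms by (induction d) (simp_all add: ring_distribs symmetric_of_degree_add)

lemma symmetric_of_degree_mconst_mult:
  assumes "symmetric_of_degree r f"
  shows "symmetric_of_degree r (mconst a * f)"
  using symmetric_of_degree_mult[OF symmetric_of_degree_mconst assms] by simp

section \<open>Power series in x with symmetric coefficients of one fixed degree\<close>

definition sym_fps :: "nat \<Rightarrow> ('n::finite) mpoly fps \<Rightarrow> bool" where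
  "sym_fps r f \<longleftrightarrow> (\<forall>d. symmetric_of_degree r (fps_nth f d))"

lemma sym_fps_0 [simp]: "sym_fps r 0"
  by (simp add: sym_fps_def)

lemma sym_fps_diff: "sym_fps r f \<Longrightarrow> sym_fps r g \<Longrightarrow> sym_fps r (f - g)"
  by (simp add: sym_fps_def symmetric_of_degree_diff)

lemma sym_fps_uminus: "sym_fps r f \<Longrightarrow> sym_fps r (- f)"
  by (simp add: sym_fps_def symmetric_of_degree_uminus)

lemma sym_fps_sum: "(\<And>x. x \<in> S \<Longrightarrow> sym_fps r (f x)) \<Longrightarrow> sym_fps r (\<Sum>x\<in>S. f x)"
  by (auto simp: sym_fps_def fps_sum_nth intro: symmetric_of_degree_sum)

lemma sym_fps_1: "sym_fps 0 1"
  using symmetric_of_degree_mconst[of 1] by (simp add: sym_fps_def mconst_1)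

lemma sym_fps_mult: "sym_fps r f \<Longrightarrow> sym_fps s g \<Longrightarrow> sym_fps (r + s) (f * g)"
  by (auto simp: sym_fps_def fps_mult_nth intro!: symmetric_of_degree_sum symmetric_of_degree_mult)

text \<open>Each new coefficient is minus a sum of products of coefficients of degree 0; the
  starting value 1 means that nothing is divided in the polynomial ring.\<close>

lemma sym_fps_right_inverse:
  assumes "sym_fps 0 f"
  shows "sym_fps 0 (fps_right_inverse f 1)"
proof -
  have "symmetric_of_degree 0 (fps_right_inverse_constructor f 1 d)" for d
  proof (induction d rule: less_induct)
    case (less d)
    show ?case
    proof (cases d)
      case 0
      then show ?thesis
        using symmetric_of_degree_mconst[of 1] by (simp add: mconst_1)
    next
      case (Suc d')
      have "symmetric_of_degree 0 (fps_nth f i * fps_right_inverse_constructor f 1 (Suc d' - i))"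
        if "i \<in> {1..Suc d'}" for i
        using symmetric_of_degree_mult[of 0 "fps_nth f i" 0] assms less[of "Suc d' - i"] that Suc
        by (auto simp: sym_fps_def)
      then show ?thesis
        unfolding Suc fps_right_inverse_constructor.simps mult_minus_left mult_1_left
        by (intro symmetric_of_degree_uminus symmetric_of_degree_sum)
    qed
  qed
  then show ?thesis by (simp add: sym_fps_def)
qed


section \<open>Congruence of hypergeometric data\<close>

text \<open>The relation does not involve t, so divisibility of every t-coefficient is divisibility
  by the constant polynomial \<open>[:rel_P:]\<close>. This exhibits a congruence modulo an
  ideal.\<close>

lemma eq_HG_iff:
  "eq_HG F G \<longleftrightarrow> (\<forall>d z. [:rel_P:] dvd fls_nth (fps_nth (F - G) d) z)"
  by (auto simp: eq_HG_def eq_P_def const_poly_dvd_iff)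

lemma dvd_fls_nth_mult:
  fixes c :: "'a::comm_ring_1"
  assumes "\<And>z. c dvd fls_nth f z"
  shows "c dvd fls_nth (g * f) z"
  unfolding fls_times_nth(2) using assms by (intro dvd_sum dvd_mult)

lemma eq_HG_mult:
  assumes "eq_HG F G"
  shows "eq_HG (H * F) (H * G)"
proof -
  have "[:rel_P:] dvd fls_nth (fps_nth (H * (F - G)) d) z" for d z
    using assms
    by (auto simp: eq_HG_iff fps_mult_nth fls_nth_sum intro!: dvd_sum dvd_fls_nth_mult)
  then show ?thesis unfolding eq_HG_iff right_diff_distrib by blast
qed

lemma eq_HG_diff:
  assumes "eq_HG F G" "eq_HG F' G'"
  shows "eq_HG (F - F') (G - G')"
proof -
  have "F - F' - (G - G') = (F - G) - (F' - G')" by simp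
  then have "fls_nth (fps_nth (F - F' - (G - G')) d) z =
      fls_nth (fps_nth (F - G) d) z - fls_nth (fps_nth (F' - G') d) z" for d z
    by (simp only: fps_sub_nth fls_minus_nth)
  then show ?thesis using assms unfolding eq_HG_iff by (metis dvd_diff)
qed

lemma eq_HG_refl: "eq_HG F F"
  by (simp add: eq_HG_iff)

lemma eq_HG_add:
  assumes "eq_HG F G" "eq_HG F' G'"
  shows "eq_HG (F + F') (G + G')"
  using eq_HG_diff[OF assms(1) eq_HG_diff[OF eq_HG_refl[of 0] assms(2)]] by simp

lemma eq_HG_sum:
  assumes "\<And>x. x \<in> S \<Longrightarrow> eq_HG (f x) (g x)"
  shows "eq_HG (\<Sum>x\<in>S. f x) (\<Sum>x\<in>S. g x)"
  using assms by (induction S rule: infinite_finite_induct) (simp_all add: eq_HG_add eq_HG_refl)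

text \<open>As a power series in hbar^-1 the exponential has constant term 1.\<close>

lemma exp_pt_unit: "exp_pt dvd (1 :: ('n::{finite,linorder}) laurent)"
proof -
  define E :: "'n RT poly poly fps" where
    "E = Abs_fps (\<lambda>m. monom (monom (to_RT (mconst ((-1) ^ m / fact m))) m) m)"
  interpret ring_map "to_RT :: 'n mpoly \<Rightarrow> _" by (rule ring_map_to_RT)
  have "fps_nth E 0 * 1 = 1"
    by (simp add: E_def mconst_1 map_one monom_0 one_pCons)
  then have "E * fps_right_inverse E 1 = 1" by (rule fps_right_inverse)
  then have "fps_to_fls E * fps_to_fls (fps_right_inverse E 1) = 1"
    by (simp flip: fls_times_fps_to_fls)
  then have "1 = exp_pt * fps_to_fls (fps_right_inverse E 1)"
    by (simp only: exp_pt_def flip: E_def)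
  then show ?thesis by (rule dvdI)
qed

lemma eq_HG_exp_pt_cancel:
  assumes "eq_HG (fps_const exp_pt * F) (fps_const exp_pt * G)"
  shows "eq_HG F G"
proof -
  from exp_pt_unit obtain e :: "'a laurent" where "1 = exp_pt * e" by (rule dvdE)
  then have "fps_const e * fps_const exp_pt = 1"
    by (simp add: mult.commute)
  then have "fps_const e * (fps_const exp_pt * H) = H" for H :: "'a laurent fps"
    by (simp only: mult.assoc[symmetric] mult_1_left)
  then show ?thesis using eq_HG_mult[OF assms, of "fps_const e"] by (simp only:)
qed

text \<open>The operator \<open>p - \<hbar>\<theta>\<close>, that is \<open>-\<hbar> d/dt\<close> conjugated by \<open>e\<^sup>-\<^sup>p\<^sup>t\<^sup>/\<^sup>\<hbar>\<close>.\<close>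

definition hbar_theta :: "('n::{finite,linorder}) laurent fps \<Rightarrow> 'n laurent fps" where
  "hbar_theta F = Abs_fps (\<lambda>d. (fls_const [:[:0, 1:]:] - of_nat d * fls_X_inv) * fps_nth F d)"

text \<open>On each x-coefficient the operator is multiplication by a fixed Laurent series.\<close>

lemma eq_HG_hbar_theta:
  assumes "eq_HG F G"
  shows "eq_HG (hbar_theta F) (hbar_theta G)"
proof -
  have "[:rel_P:] dvd fls_nth (fps_nth (hbar_theta F - hbar_theta G) d) z" for d z
  proof -
    have "fps_nth (hbar_theta F - hbar_theta G) d =
        (fls_const [:[:0, 1:]:] - of_nat d * fls_X_inv) * fps_nth (F - G) d"
      by (simp only: hbar_theta_def fps_sub_nth fps_nth_Abs_fps right_diff_distrib)
    then show ?thesis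
      using assms unfolding eq_HG_iff by (metis dvd_fls_nth_mult)
  qed
  then show ?thesis by (simp only: eq_HG_iff simp_thms)
qed


section \<open>Operations on Euler data\<close>

lemma ring_map_pullback: "ring_map (pullback :: ('n::{finite,linorder}) RT poly poly \<Rightarrow> _)"
  unfolding pullback_def
  by (intro ring_map_comp[OF ring_map_poly] ring_map_map_poly ring_map_comp[OF ring_map_fls_const]
      ring_map_comp[OF ring_map_const_poly] ring_map_const_poly)

lemma pullback_const: "pullback [:[:a:]:] = fls_const [:[:a:]:]"
  by (simp add: pullback_def map_poly_pCons)

lemma pullback_kappa:
  "pullback [:- [:0, of_nat d:], 1:] =
     (fls_const [:[:0, 1:]:] - of_nat d * fls_X_inv :: ('n::{finite,linorder}) laurent)"
proof -
  fix l :: 'n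
  interpret ring_map "pullback :: 'n RT poly poly \<Rightarrow> _" by (rule ring_map_pullback)
  \<comment> \<open>Any index \<open>l\<close> serves: adding and removing \<open>lam l\<close>
    reduces kappa - d hbar to the case of \<open>pullback_linear\<close>.\<close>
  have "[:- [:0, of_nat d:], 1:] = [:- weight l d, 1:] + [:[:lam l:]:]"
    by (simp add: weight_def)
  then have "pullback [:- [:0, of_nat d:], 1:] =
      fls_const [:[:- lam l, 1:]:] - of_nat d * fls_X_inv + fls_const [:[:lam l:]:]"
    by (simp only: map_add pullback_linear pullback_const)
  also have "fls_const [:[:- lam l, 1:]:] = fls_const [:[:0, 1:]:] - fls_const [:[:lam l:]:]"
    by (simp add: fls_minus_const)
  finally show ?thesis by simp
qed

definition hg :: "(nat \<Rightarrow> ('n::{finite,linorder}) RT poly poly) \<Rightarrow> 'n laurent fps" where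
  "hg Q = Abs_fps (\<lambda>d. pullback (Q d) * (\<Prod>l\<in>UNIV. \<Prod>m=1..d. inv_factor l m))"

lemma HG_eq: "HG Q = fps_const exp_pt * hg Q"
  by (simp add: HG_def hg_def)

definition theta_data ::
  "(nat \<Rightarrow> ('n::{finite,linorder}) RT poly poly) \<Rightarrow> nat \<Rightarrow> 'n RT poly poly" where
  "theta_data Q d = [:- [:0, of_nat d:], 1:] * Q d"

text \<open>
  The product cancels the factors by which the denominators of degrees \<open>d - s\<close> and \<open>d\<close> differ.
\<close>

definition mult_data ::
  "('n::{finite,linorder}) mpoly fps \<Rightarrow> (nat \<Rightarrow> 'n RT poly poly) \<Rightarrow> nat \<Rightarrow> 'n RT poly poly" where
  "mult_data f Q d = (\<Sum>s\<le>d. [:[:to_RT (fps_nth f s):]:] * Q (d - s) *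
     (\<Prod>l\<in>UNIV. \<Prod>m\<in>{d - s<..d}. [:- weight l m, 1:]))"

definition emb_laurent :: "('n::{finite,linorder}) mpoly fps \<Rightarrow> 'n laurent fps" where
  "emb_laurent f = Abs_fps (\<lambda>d. fls_const [:[:to_RT (fps_nth f d):]:])"

lemma ring_map_emb_laurent: "ring_map (emb_laurent :: ('n::{finite,linorder}) mpoly fps \<Rightarrow> _)"
  unfolding emb_laurent_def
  by (intro ring_map_fps ring_map_comp[OF ring_map_fls_const] ring_map_comp[OF ring_map_const_poly]
      ring_map_comp[OF ring_map_const_poly] ring_map_to_RT)

lemma hg_theta_data: "hg (theta_data Q) = hbar_theta (hg Q)"
proof -
  interpret ring_map "pullback :: 'a RT poly poly \<Rightarrow> _" by (rule ring_map_pullback)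
  show ?thesis
    by (rule fps_ext) (simp only: hg_def hbar_theta_def theta_data_def map_mult pullback_kappa
        fps_nth_Abs_fps mult.assoc)
qed

lemma hg_diff_sum:
  "hg (\<lambda>d. Q d - (\<Sum>j\<in>S. R j d)) = hg Q - (\<Sum>j\<in>S. hg (R j))"
proof -
  interpret ring_map "pullback :: 'a RT poly poly \<Rightarrow> _" by (rule ring_map_pullback)
  show ?thesis
    by (rule fps_ext) (simp only: hg_def map_diff map_sum fps_sum_nth fps_sub_nth fps_nth_Abs_fps
        left_diff_distrib sum_distrib_right)
qed

text \<open>The pulled-back product in \<open>mult_data\<close> turns the denominator of degree
  \<open>d\<close> into that of degree \<open>d - s\<close>, leaving a plain Cauchy product in
  x.\<close>

lemma hg_mult_data: "hg (mult_data f Q) = emb_laurent f * hg Q"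
proof (rule fps_ext)
  fix d
  interpret ring_map "pullback :: 'a RT poly poly \<Rightarrow> _" by (rule ring_map_pullback)
  define D :: "nat \<Rightarrow> 'a laurent" where "D d = (\<Prod>l\<in>UNIV. \<Prod>m=1..d. inv_factor l m)" for d
  have D: "(\<Prod>l\<in>UNIV. \<Prod>m\<in>{d - s<..d}. pullback [:- weight l m, 1:]) * D d = D (d - s)" for s
  proof -
    have "(\<Prod>m\<in>{d - s<..d}. pullback [:- weight l m, 1:]) * (\<Prod>m=1..d. inv_factor l m) =
        (\<Prod>m=1..d-s. inv_factor l m)" for l :: 'a
    proof -
      have "{1..d} = {1..d-s} \<union> {d - s<..d}" by auto
      then have "(\<Prod>m=1..d. inv_factor l m) =
          (\<Prod>m=1..d-s. inv_factor l m) * (\<Prod>m\<in>{d - s<..d}. inv_factor l m)"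
        by (simp only:) (subst prod.union_disjoint, auto)
      \<comment> \<open>Here \<open>m > d - s\<close>, so \<open>m\<close> is at least 1 and
        \<open>inv_factor\<close> applies.\<close>
      moreover have "(\<Prod>m\<in>{d - s<..d}. pullback [:- weight l m, 1:] * inv_factor l m) = 1"
        by (intro prod.neutral ballI inv_factor) auto
      ultimately show ?thesis
        by (simp add: prod.distrib algebra_simps del: prod_eq_1_iff)
    qed
    then show ?thesis by (simp add: D_def flip: prod.distrib)
  qed
  have "fps_nth (hg (mult_data f Q)) d = (\<Sum>s\<le>d. fls_const [:[:to_RT (fps_nth f s):]:] *
      pullback (Q (d - s)) * ((\<Prod>l\<in>UNIV. \<Prod>m\<in>{d - s<..d}. pullback [:- weight l m, 1:]) * D d))"
    by (simp add: hg_def mult_data_def D_def map_simps pullback_const sum_distrib_right mult.assoc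
        del: mult_pCons_left mult_pCons_right)
  also have "\<dots> = fps_nth (emb_laurent f * hg Q) d"
    unfolding D fps_mult_nth atMost_atLeast0
    by (simp add: emb_laurent_def hg_def D_def mult.assoc)
  finally show "fps_nth (hg (mult_data f Q)) d = fps_nth (emb_laurent f * hg Q) d" .
qed

text \<open>The gluing clause of \<open>linked_euler_data\<close> at a single height, with
  \<open>A\<close> as height 0 data; taking \<open>Q = A\<close> gives that of
  \<open>euler_data\<close>. For fixed \<open>A\<close> it is linear in \<open>Q\<close>.\<close>

definition linked ::
  "('n::{finite,linorder}) RT poly \<Rightarrow> (nat \<Rightarrow> 'n RT poly poly) \<Rightarrow> (nat \<Rightarrow> 'n RT poly poly) \<Rightarrow> bool"
where
  "linked \<Omega> A Q \<longleftrightarrow> (\<forall>i d r. r \<le> d \<longrightarrow>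
     [:poly \<Omega> (lam i):] * poly (Q d) (weight i r) =
       poly (A r) (weight i r) * poly (Q (d - r)) (weight i 0))"

lemma linked_diff_sum:
  assumes "linked \<Omega> A Q" "\<And>j. j \<in> S \<Longrightarrow> linked \<Omega> A (R j)"
  shows "linked \<Omega> A (\<lambda>d. Q d - (\<Sum>j\<in>S. R j d))"
  unfolding linked_def
proof (intro allI impI)
  fix i d and r :: nat
  assume r: "r \<le> d"
  have 1: "[:poly \<Omega> (lam i):] * poly (Q d) (weight i r) =
      poly (A r) (weight i r) * poly (Q (d - r)) (weight i 0)"
    using assms(1) r unfolding linked_def by blast
  have 2: "[:poly \<Omega> (lam i):] * poly (R j d) (weight i r) =
      poly (A r) (weight i r) * poly (R j (d - r)) (weight i 0)" if "j \<in> S" for j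
    using assms(2)[OF that] r unfolding linked_def by blast
  show "[:poly \<Omega> (lam i):] * poly (Q d - (\<Sum>j\<in>S. R j d)) (weight i r) =
      poly (A r) (weight i r) * poly (Q (d - r) - (\<Sum>j\<in>S. R j (d - r))) (weight i 0)"
    unfolding poly_diff poly_sum right_diff_distrib sum_distrib_left 1
    by (rule arg_cong[of _ _ "(-) _"], rule sum.cong) (simp_all only: 2)
qed

text \<open>At lambda_i + r hbar the factor kappa - d hbar becomes lambda_i - (d - r) hbar, which is
  the factor of degree \<open>d - r\<close> at lambda_i.\<close>

lemma linked_theta_data:
  assumes "linked \<Omega> A Q"
  shows "linked \<Omega> A (theta_data Q)"
  unfolding linked_def
proof (intro allI impI)
  fix i d and r :: nat
  assume r: "r \<le> d"
  have *: "poly [:- [:0, of_nat d:], 1:] (weight i r) =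
      (poly [:- [:0, of_nat (d - r):], 1:] (weight i 0) :: 'a RT poly)"
    using r by (simp add: weight_def)
  have **: "[:poly \<Omega> (lam i):] * poly (Q d) (weight i r) =
       poly (A r) (weight i r) * poly (Q (d - r)) (weight i 0)"
    using assms r unfolding linked_def by blast
  have "a * (b * c) = e * (b * c')" if "a * c = e * c'" for a b c c' e :: "'a RT poly"
    using that by (simp only: mult.left_commute[of _ b])
  then show "[:poly \<Omega> (lam i):] * poly (theta_data Q d) (weight i r) =
       poly (A r) (weight i r) * poly (theta_data Q (d - r)) (weight i 0)"
    unfolding theta_data_def poly_mult * using ** by blast
qed

text \<open>At \<open>weight i r\<close> the products with \<open>s > d - r\<close> vanish, the
  others equal those of degree \<open>d - r\<close> at \<open>weight i 0\<close>, and linkage of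
  \<open>Q\<close> applies term by term.\<close>

lemma linked_mult_data:
  fixes Q :: "nat \<Rightarrow> ('n::{finite,linorder}) RT poly poly"
  assumes "linked \<Omega> A Q"
  shows "linked \<Omega> A (mult_data f Q)"
  unfolding linked_def
proof (intro allI impI)
  fix i :: 'n and d and r :: nat
  assume r: "r \<le> d"
  define Z :: "nat \<Rightarrow> nat \<Rightarrow> nat \<Rightarrow> 'n RT poly"
    where "Z d r s = (\<Prod>l\<in>UNIV. \<Prod>m\<in>{d - s<..d}. weight i r - weight l m)" for d r s
  have P: "poly (mult_data f Q d) (weight i r) =
      (\<Sum>s\<le>d. [:to_RT (fps_nth f s):] * poly (Q (d - s)) (weight i r) * Z d r s)" for d r
    by (simp add: mult_data_def Z_def poly_sum poly_prod del: mult_pCons_left)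
  \<comment> \<open>For \<open>s > d - r\<close> the factor with \<open>l = i\<close>, \<open>m = r\<close> vanishes.\<close>
  have Z0: "Z d r s = 0" if "s \<in> {..d} - {..d - r}" for s
    unfolding Z_def using that r
    by (intro prod_zero bexI[of _ i]) (auto intro!: prod_zero bexI[of _ r])
  \<comment> \<open>The hbar part of a difference of weights depends only on \<open>r\<close> minus
    \<open>m\<close>, so shifting \<open>m\<close> by \<open>r\<close> matches the factors.\<close>
  have Zs: "Z d r s = Z (d - r) 0 s" if "s \<le> d - r" for s
  proof -
    have "(\<Prod>m\<in>{d - s<..d}. weight i r - weight l m) =
        (\<Prod>m\<in>{d - r - s<..d - r}. weight i 0 - weight l m)" for l
      by (rule prod.reindex_bij_witness[of _ "\<lambda>m. m + r" "\<lambda>m. m - r"])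
        (use that r in \<open>auto simp: weight_def\<close>)
    then show ?thesis by (simp add: Z_def)
  qed
  have "[:poly \<Omega> (lam i):] * poly (mult_data f Q d) (weight i r) =
      [:poly \<Omega> (lam i):] *
        (\<Sum>s\<le>d - r. [:to_RT (fps_nth f s):] * poly (Q (d - s)) (weight i r) * Z d r s)"
    unfolding P by (rule arg_cong[of _ _ "(*) _"], rule sum.mono_neutral_right) (auto simp: Z0)
  also have "\<dots> = (\<Sum>s\<le>d - r. [:to_RT (fps_nth f s):] *
      ([:poly \<Omega> (lam i):] * poly (Q (d - s)) (weight i r)) * Z (d - r) 0 s)"
    unfolding sum_distrib_left by (rule sum.cong) (simp_all only: atMost_iff Zs mult_ac)
  also have "\<dots> = (\<Sum>s\<le>d - r. [:to_RT (fps_nth f s):] *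
      (poly (A r) (weight i r) * poly (Q (d - r - s)) (weight i 0)) * Z (d - r) 0 s)"
  proof (rule sum.cong[OF refl])
    fix s assume "s \<in> {..d - r}"
    then have *: "r \<le> d - s" "d - s - r = d - r - s" using r by auto
    have "[:poly \<Omega> (lam i):] * poly (Q (d - s)) (weight i r) =
       poly (A r) (weight i r) * poly (Q (d - r - s)) (weight i 0)"
      using assms *(1) unfolding linked_def *(2)[symmetric] by blast
    from arg_cong[OF this, of "\<lambda>x. [:to_RT (fps_nth f s):] * x * Z (d - r) 0 s"]
    show "[:to_RT (fps_nth f s):] *
      ([:poly \<Omega> (lam i):] * poly (Q (d - s)) (weight i r)) * Z (d - r) 0 s =
      [:to_RT (fps_nth f s):] *
      (poly (A r) (weight i r) * poly (Q (d - r - s)) (weight i 0)) * Z (d - r) 0 s" .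
  qed
  also have "\<dots> = poly (A r) (weight i r) * poly (mult_data f Q (d - r)) (weight i 0)"
    unfolding P sum_distrib_left by (rule sum.cong) (simp_all only: mult_ac)
  finally show "[:poly \<Omega> (lam i):] * poly (mult_data f Q d) (weight i r) =
       poly (A r) (weight i r) * poly (mult_data f Q (d - r)) (weight i 0)" .
qed


section \<open>Expansions in the inverse of the equivariant parameter\<close>

definition theta :: "'a::comm_ring_1 fps \<Rightarrow> 'a fps" where
  "theta f = Abs_fps (\<lambda>d. of_nat d * fps_nth f d)"

lemma theta_nth [simp]: "fps_nth (theta f) d = of_nat d * fps_nth f d"
  by (simp add: theta_def)

lemma theta_sum: "theta (\<Sum>x\<in>S. f x) = (\<Sum>x\<in>S. theta (f x))"
  by (rule fps_ext) (simp add: fps_sum_nth sum_distrib_left)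

lemma theta_mult_const: "theta (f * fps_const c) = theta f * fps_const c"
  by (rule fps_ext) (simp add: mult.assoc)

lemma theta_const: "theta (fps_const c) = 0"
  by (rule fps_ext) simp

lemma sym_fps_theta: "sym_fps r f \<Longrightarrow> sym_fps r (theta f)"
  by (simp add: sym_fps_def symmetric_of_degree_of_nat_mult)

definition emb_poly :: "('n::{finite,linorder}) mpoly fps \<Rightarrow> 'n RT poly poly fps" where
  "emb_poly f = Abs_fps (\<lambda>d. [:[:to_RT (fps_nth f d):]:])"

lemma ring_map_emb_poly: "ring_map (emb_poly :: ('n::{finite,linorder}) mpoly fps \<Rightarrow> _)"
  unfolding emb_poly_def
  by (intro ring_map_fps ring_map_comp[OF ring_map_const_poly]
      ring_map_comp[OF ring_map_const_poly] ring_map_to_RT)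

lemma emb_poly_theta: "emb_poly (theta f) = theta (emb_poly f)"
proof -
  interpret ring_map "\<lambda>a :: 'a mpoly. [:[:to_RT a:]:]"
    by (intro ring_map_comp[OF ring_map_const_poly] ring_map_comp[OF ring_map_const_poly] ring_map_to_RT)
  show ?thesis
    by (rule fps_ext) (simp only: emb_poly_def theta_nth fps_nth_Abs_fps map_mult map_of_nat)
qed

text \<open>The coefficient of hbar^-z, taken across all degrees in x at once, so that identities of
  data become identities of x-series.\<close>

definition hcoeff :: "int \<Rightarrow> 'a::comm_ring_1 fls fps \<Rightarrow> 'a fps" where
  "hcoeff z F = Abs_fps (\<lambda>d. fls_nth (fps_nth F d) z)"

lemma hcoeff_eqI: "(\<And>z. hcoeff z F = hcoeff z G) \<Longrightarrow> F = G"
  by (simp add: hcoeff_def fps_eq_iff fls_eq_iff)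

lemma hcoeff_diff: "hcoeff z (F - G) = hcoeff z F - hcoeff z G"
  by (simp add: hcoeff_def fps_eq_iff)

lemma hcoeff_sum: "hcoeff z (\<Sum>x\<in>S. F x) = (\<Sum>x\<in>S. hcoeff z (F x))"
  by (rule fps_ext) (simp add: hcoeff_def fps_sum_nth fls_nth_sum)

lemma hcoeff_emb_laurent_mult: "hcoeff z (emb_laurent f * F) = emb_poly f * hcoeff z F"
  by (rule fps_ext)
    (simp only: hcoeff_def emb_laurent_def emb_poly_def fps_mult_nth fls_nth_sum fps_nth_Abs_fps
      fls_mult_const_nth)

text \<open>Multiplication by hbar lowers the exponent of hbar^-1 by one, whence the index
  \<open>z + 1\<close>.\<close>

lemma hcoeff_hbar_theta:
  "hcoeff z (hbar_theta F) = fps_const [:[:0, 1:]:] * hcoeff z F - theta (hcoeff (z + 1) F)"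
proof (rule fps_ext)
  fix d
  have "fls_nth ((fls_const [:[:0, 1:]:] - of_nat d * fls_X_inv) * fps_nth F d) z =
      [:[:0, 1:]:] * fls_nth (fps_nth F d) z - of_nat d * fls_nth (fps_nth F d) (z + 1)"
    by (simp only: left_diff_distrib mult.assoc[of "of_nat d"]
        fls_X_inv_times_conv_shift(1) fls_minus_nth fls_mult_of_nat_nth fls_shift_nth
        fls_mult_const_nth)
  then show "fps_nth (hcoeff z (hbar_theta F)) d =
      fps_nth (fps_const [:[:0, 1:]:] * hcoeff z F - theta (hcoeff (z + 1) F)) d"
    by (simp only: hcoeff_def hbar_theta_def fps_nth_Abs_fps fps_sub_nth fps_mult_left_const_nth theta_nth)
qed

text \<open>Coefficients outside this range are never read, so they may be truncated freely.\<close>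

lemma hseries_cong:
  assumes "\<And>d q r. q \<ge> 1 \<Longrightarrow> r \<le> q + k \<Longrightarrow> A d q r = B d q r"
  shows "hseries k \<Omega> A = hseries k \<Omega> B"
  unfolding hseries_def using assms
  by (intro arg_cong[of _ _ Abs_fps] ext arg_cong[of _ _ fps_to_fls]) (auto intro!: sum.cong)

text \<open>
  Here \<open>C q r\<close> is the series \<open>\<Sum>\<^sub>d c\<^sup>r\<^sub>d\<^sub>,\<^sub>q x\<^sup>d\<close>, without constant term in all applications. Making it
  vanish for \<open>r > q + k\<close> as well removes the case distinctions on \<open>r\<close> from the recursion.
\<close>

definition xseries ::
  "nat \<Rightarrow> ('n::{finite,linorder}) RT poly \<Rightarrow> (nat \<Rightarrow> nat \<Rightarrow> 'n mpoly fps) \<Rightarrow> 'n laurent fps" where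
  "xseries k \<Omega> C = hseries k \<Omega> (\<lambda>d q r. [:fps_nth (C q r) d:])"

lemma hcoeff_xseries_neg: "z < 0 \<Longrightarrow> hcoeff z (xseries k \<Omega> C) = 0"
  by (rule fps_ext) (simp add: hcoeff_def xseries_def hseries_def)

lemma hcoeff_xseries_0: "hcoeff 0 (xseries k \<Omega> C) = fps_const [:\<Omega> * [:0, 1:] ^ k:]"
  by (rule fps_ext) (simp add: hcoeff_def xseries_def hseries_def)

lemma hcoeff_xseries_pos:
  assumes "q \<ge> 1"
  shows "hcoeff (int q) (xseries k \<Omega> C) =
    (\<Sum>r\<le>q + k. emb_poly (C q r) * fps_const [:\<Omega> * [:0, 1:] ^ (q + k - r):])"
proof -
  interpret ring_map "to_RT :: 'a mpoly \<Rightarrow> _" by (rule ring_map_to_RT)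
  have "map_poly (\<lambda>a. [:to_RT a:]) [:c:] = [:[:to_RT c:]:]" for c :: "'a mpoly"
    by (simp add: map_poly_pCons map_zero)
  then show ?thesis
    using assms by (intro fps_ext)
      (simp add: hcoeff_def xseries_def hseries_def emb_poly_def fps_sum_nth add.commute[of k])
qed


section \<open>The recursion\<close>

text \<open>With \<open>C\<close> the coefficients at height k, this is the series g_j of the
  overview: the 1 comes from p times the leading term, the rest from -hbar theta acting on the
  hbar^-1 terms.\<close>

definition gfac :: "(nat \<Rightarrow> nat \<Rightarrow> 'a::comm_ring_1 fps) \<Rightarrow> nat \<Rightarrow> 'a fps" where
  "gfac C j = (if j = 0 then 1 else 0) - theta (C 1 j)"

definition gfac_inv :: "(nat \<Rightarrow> nat \<Rightarrow> 'a::comm_ring_1 fps) \<Rightarrow> 'a fps" where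
  "gfac_inv C = fps_right_inverse (gfac C 0) 1"

text \<open>\<open>theta\<close> kills constant terms, so \<open>gfac C 0\<close> starts with
  1.\<close>

lemma gfac_inv: "gfac C 0 * gfac_inv C = 1"
  unfolding gfac_inv_def by (rule fps_right_inverse) (simp add: gfac_def)

lemma gfac_inv_nth_0: "fps_nth (gfac_inv C) 0 = 1"
  by (simp add: gfac_inv_def)

lemma gfac_nth_0: "j > 0 \<Longrightarrow> fps_nth (gfac C j) 0 = 0"
  by (simp add: gfac_def)

text \<open>Height k coefficients, found by comparing coefficients of p^(q-r) hbar^-q. Height k+1-j
  carries j fewer powers of p, which shifts \<open>r\<close> by \<open>j\<close>; the guard avoids
  truncated subtraction.\<close>

fun cser :: "(nat \<Rightarrow> nat \<Rightarrow> 'a::comm_ring_1 fps) \<Rightarrow> nat \<Rightarrow> nat \<Rightarrow> nat \<Rightarrow> 'a fps" where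
  "cser C 0 = C"
| "cser C (Suc k) = (\<lambda>q r. gfac_inv (cser C k) *
     (cser C k q r - theta (cser C k (Suc q) r) -
      (\<Sum>j=1..Suc k. if j \<le> r then gfac (cser C k) j * cser C (Suc k - j) q (r - j) else 0)))"

text \<open>The recursion of \<open>cser\<close> on the level of classes: \<open>theta_data\<close>
  realises p - hbar theta and \<open>mult_data\<close> multiplication by a series.\<close>

fun euler_ext :: "(nat \<Rightarrow> nat \<Rightarrow> ('n::{finite,linorder}) mpoly fps) \<Rightarrow>
    (nat \<Rightarrow> 'n RT poly poly) \<Rightarrow> nat \<Rightarrow> nat \<Rightarrow> 'n RT poly poly" where
  "euler_ext C P 0 = P"
| "euler_ext C P (Suc k) = mult_data (gfac_inv (cser C k))
     (\<lambda>d. theta_data (euler_ext C P k) d -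
       (\<Sum>j=1..Suc k. mult_data (gfac (cser C k) j) (euler_ext C P (Suc k - j)) d))"

declare cser.simps(2) [simp del] euler_ext.simps(2) [simp del]

section \<open>Constant terms, vanishing range and degrees of the recursive coefficients\<close>

lemma cser_nth_0:
  assumes "\<And>q r. fps_nth (C q r) 0 = 0"
  shows "fps_nth (cser C k q r) 0 = 0"
proof (induction k arbitrary: q r)
  case (Suc k)
  have "fps_nth (if j \<le> r then gfac (cser C k) j * cser C (Suc k - j) q (r - j) else 0) 0 = 0"
    if "j \<in> {1..Suc k}" for j
    using that by (simp add: gfac_nth_0)
  then show ?case
    unfolding cser.simps fps_mult_nth_0 fps_sub_nth fps_sum_nth by (simp add: Suc)
qed (use assms in simp)

text \<open>The bound grows by one per height because of the term with \<open>Suc q\<close>; in the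
  sum, \<open>r\<close> and the height drop together by \<open>j\<close>.\<close>

lemma cser_eq_0:
  assumes "\<And>q r. r > q \<Longrightarrow> C q r = 0" and "r > q + k"
  shows "cser C k q r = 0"
  using assms(2)
proof (induction k arbitrary: q r rule: less_induct)
  case (less k)
  show ?case
  proof (cases k)
    case (Suc k')
    have "(if j \<le> r then gfac (cser C k') j * cser C (Suc k' - j) q (r - j) else 0) = 0"
      if "j \<in> {1..Suc k'}" for j
    proof -
      have "cser C (Suc k' - j) q (r - j) = 0"
        using that less.prems Suc by (intro less.IH) auto
      then show ?thesis by simp
    qed
    moreover have "cser C k' q r = 0" "cser C k' (Suc q) r = 0"
      using less.prems Suc by (auto intro!: less.IH)
    ultimately show ?thesis
      unfolding Suc cser.simps by (simp add: theta_def flip: fps_zero_def)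
  qed (use assms(1) less.prems in simp)
qed

lemma sym_fps_gfac:
  assumes "\<And>q r. sym_fps r (C q r)"
  shows "sym_fps j (gfac C j)"
  unfolding gfac_def using assms by (auto intro!: sym_fps_diff sym_fps_uminus sym_fps_theta sym_fps_1)

text \<open>The recursion is homogeneous: \<open>gfac\<close> of index \<open>j\<close> has degree
  \<open>j\<close> and meets a coefficient of degree \<open>r - j\<close>, and dividing by
  \<open>gfac\<close> of index 0 keeps degrees.\<close>

lemma sym_fps_cser:
  assumes "\<And>q r. sym_fps r (C q r)"
  shows "sym_fps r (cser C k q r)"
proof (induction k arbitrary: q r rule: less_induct)
  case (less k)
  show ?case
  proof (cases k)
    case (Suc k')
    have g: "sym_fps j (gfac (cser C k') j)" for j
      by (rule sym_fps_gfac) (auto intro: less.IH simp: Suc)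
    have "sym_fps r (if j \<le> r then gfac (cser C k') j * cser C (Suc k' - j) q (r - j) else 0)"
      if "j \<in> {1..Suc k'}" for j
      using sym_fps_mult[OF g[of j] less.IH[of "Suc k' - j" "r - j" q]] that Suc by auto
    then have "sym_fps r (cser C k' q r - theta (cser C k' (Suc q) r) -
        (\<Sum>j=1..Suc k'. if j \<le> r then gfac (cser C k') j * cser C (Suc k' - j) q (r - j) else 0))"
      by (intro sym_fps_diff sym_fps_sum sym_fps_theta less.IH) (auto simp: Suc)
    from sym_fps_mult[OF sym_fps_right_inverse[OF g] this] show ?thesis
      unfolding Suc cser.simps gfac_inv_def by simp
  qed (use assms in simp)
qed

lemma gfac_mult_cser_Suc:
  "gfac (cser C k) 0 * cser C (Suc k) q r = cser C k q r - theta (cser C k (Suc q) r) -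
      (\<Sum>j=1..Suc k. if j \<le> r then gfac (cser C k) j * cser C (Suc k - j) q (r - j) else 0)"
  unfolding cser.simps mult.assoc[symmetric] gfac_inv mult_1_left ..

text \<open>An exact identity, formal in p, checked for each power of hbar. Order 0 holds by the
  choice of \<open>gfac\<close>, negative powers of hbar by the recursion of
  \<open>cser\<close>.\<close>

lemma xseries_cser_Suc:
  fixes C :: "nat \<Rightarrow> nat \<Rightarrow> ('n::{finite,linorder}) mpoly fps"
  assumes C: "\<And>q r. r > q \<Longrightarrow> C q r = 0"
  shows "emb_laurent (gfac (cser C k) 0) * xseries (Suc k) \<Omega> (cser C (Suc k)) =
    hbar_theta (xseries k \<Omega> (cser C k)) -
    (\<Sum>j=1..Suc k. emb_laurent (gfac (cser C k) j) * xseries (Suc k - j) \<Omega> (cser C (Suc k - j)))"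
proof (rule hcoeff_eqI)
  fix z :: int
  interpret ring_map "emb_poly :: 'n mpoly fps \<Rightarrow> _" by (rule ring_map_emb_poly)
  let ?g = "gfac (cser C k)"
  define e :: "nat \<Rightarrow> 'n RT poly poly fps" where "e m = fps_const [:\<Omega> * [:0, 1:] ^ m:]" for m
  have pe: "fps_const [:[:0, 1:]:] * (f * e m) = f * e (Suc m)" for f m
    by (simp add: e_def mult.left_commute[of _ f])
  have pe0: "fps_const [:[:0, 1:]:] * e m = e (Suc m)" for m
    using pe[of 1] by simp
  have th: "theta (\<Sum>r\<in>S. emb_poly (f r) * e (m r)) = (\<Sum>r\<in>S. emb_poly (theta (f r)) * e (m r))"
    for S :: "nat set" and f m
    by (simp only: theta_sum e_def theta_mult_const emb_poly_theta)
  have L: "hcoeff z (emb_laurent (?g 0) * xseries (Suc k) \<Omega> (cser C (Suc k))) =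
      emb_poly (?g 0) * hcoeff z (xseries (Suc k) \<Omega> (cser C (Suc k)))"
    by (rule hcoeff_emb_laurent_mult)
  have R: "hcoeff z (hbar_theta (xseries k \<Omega> (cser C k)) -
      (\<Sum>j=1..Suc k. emb_laurent (?g j) * xseries (Suc k - j) \<Omega> (cser C (Suc k - j)))) =
      fps_const [:[:0, 1:]:] * hcoeff z (xseries k \<Omega> (cser C k)) -
      theta (hcoeff (z + 1) (xseries k \<Omega> (cser C k))) -
      (\<Sum>j=1..Suc k. emb_poly (?g j) * hcoeff z (xseries (Suc k - j) \<Omega> (cser C (Suc k - j))))"
    by (simp only: hcoeff_diff hcoeff_sum hcoeff_emb_laurent_mult hcoeff_hbar_theta)
  consider "z < 0" | "z = 0" | q where "z = int q" "q \<ge> 1"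
    by (cases z rule: int_cases3) auto
  then show "hcoeff z (emb_laurent (?g 0) * xseries (Suc k) \<Omega> (cser C (Suc k))) =
      hcoeff z (hbar_theta (xseries k \<Omega> (cser C k)) -
      (\<Sum>j=1..Suc k. emb_laurent (?g j) * xseries (Suc k - j) \<Omega> (cser C (Suc k - j))))"
    unfolding L R
  proof cases
    case 1
    \<comment> \<open>Only z = -1 needs an argument: the order 0 coefficient is constant in x, so
      \<open>theta\<close> annihilates it.\<close>
    have "theta (hcoeff (z + 1) (xseries k \<Omega> (cser C k))) = 0"
      using 1 by (cases "z = -1")
        (simp_all add: hcoeff_xseries_neg hcoeff_xseries_0 theta_const,
          metis fps_const_0_eq_0 theta_const)
    then show "emb_poly (?g 0) * hcoeff z (xseries (Suc k) \<Omega> (cser C (Suc k))) =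
      fps_const [:[:0, 1:]:] * hcoeff z (xseries k \<Omega> (cser C k)) -
      theta (hcoeff (z + 1) (xseries k \<Omega> (cser C k))) -
      (\<Sum>j=1..Suc k. emb_poly (?g j) * hcoeff z (xseries (Suc k - j) \<Omega> (cser C (Suc k - j))))"
      using 1 by (simp add: hcoeff_xseries_neg)
  next
    case 2
    have "theta (hcoeff (z + 1) (xseries k \<Omega> (cser C k))) =
        (\<Sum>r\<le>Suc k. emb_poly (theta (cser C k 1 r)) * e (Suc k - r))"
      using hcoeff_xseries_pos[of 1 k \<Omega> "cser C k"] 2
      by (simp add: th del: sum.atMost_Suc flip: e_def)
    \<comment> \<open>The term r = 0 belongs to \<open>gfac\<close> of index 0; the others cancel
      against the subtracted heights.\<close>
    also have "\<dots> = emb_poly (theta (cser C k 1 0)) * e (Suc k) +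
        (\<Sum>r=1..Suc k. emb_poly (theta (cser C k 1 r)) * e (Suc k - r))"
      unfolding atMost_atLeast0 by (subst sum.atLeast_Suc_atMost) simp_all
    finally have th1: "theta (hcoeff (z + 1) (xseries k \<Omega> (cser C k))) = \<dots>" .
    have g: "emb_poly (?g j) = - emb_poly (theta (cser C k 1 j))" if "j \<in> {1..Suc k}" for j
      using that by (simp add: gfac_def map_simps)
    have "(\<Sum>j=1..Suc k. emb_poly (?g j) * e (Suc k - j)) =
        - (\<Sum>r=1..Suc k. emb_poly (theta (cser C k 1 r)) * e (Suc k - r))"
      unfolding sum_negf[symmetric] by (rule sum.cong) (simp_all only: g mult_minus_left)
    then show "emb_poly (?g 0) * hcoeff z (xseries (Suc k) \<Omega> (cser C (Suc k))) =
      fps_const [:[:0, 1:]:] * hcoeff z (xseries k \<Omega> (cser C k)) -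
      theta (hcoeff (z + 1) (xseries k \<Omega> (cser C k))) -
      (\<Sum>j=1..Suc k. emb_poly (?g j) * hcoeff z (xseries (Suc k - j) \<Omega> (cser C (Suc k - j))))"
      unfolding th1 unfolding 2 hcoeff_xseries_0 e_def[symmetric] pe0
      by (simp add: gfac_def map_simps left_diff_distrib)
  next
    case (3 q)
    let ?N = "q + Suc k"
    have pos: "hcoeff z (xseries m \<Omega> A) = (\<Sum>r\<le>q + m. emb_poly (A q r) * e (q + m - r))" for m A
      unfolding 3(1) e_def by (rule hcoeff_xseries_pos[OF 3(2)])
    have t1: "fps_const [:[:0, 1:]:] * hcoeff z (xseries k \<Omega> (cser C k)) =
        (\<Sum>r\<le>?N. emb_poly (cser C k q r) * e (?N - r))"
    proof -
      \<comment> \<open>The sum at height \<open>k\<close> stops at \<open>q + k\<close>; this zero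
        term extends it to the common range.\<close>
      have "cser C k q ?N = 0" by (rule cser_eq_0[OF C]) auto
      then show ?thesis
        by (simp add: pos sum_distrib_left pe map_zero Suc_diff_le)
    qed
    have t2: "theta (hcoeff (z + 1) (xseries k \<Omega> (cser C k))) =
        (\<Sum>r\<le>?N. emb_poly (theta (cser C k (Suc q) r)) * e (?N - r))"
      using hcoeff_xseries_pos[of "Suc q" k \<Omega> "cser C k"]
      by (simp add: 3(1) th add.commute del: sum.atMost_Suc flip: e_def)
    have t3: "emb_poly (?g j) * hcoeff z (xseries (Suc k - j) \<Omega> (cser C (Suc k - j))) =
        (\<Sum>r\<le>?N. emb_poly (if j \<le> r then ?g j * cser C (Suc k - j) q (r - j) else 0) * e (?N - r))"
      if "j \<in> {1..Suc k}" for j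
    proof -
      have "emb_poly (?g j) * hcoeff z (xseries (Suc k - j) \<Omega> (cser C (Suc k - j))) =
          (\<Sum>r\<le>?N - j. emb_poly (?g j * cser C (Suc k - j) q r) * e (?N - j - r))"
        using that by (simp add: pos sum_distrib_left map_mult mult.assoc)
      also have "\<dots> = (\<Sum>r\<in>{j..?N}. emb_poly (?g j * cser C (Suc k - j) q (r - j)) * e (?N - r))"
        by (rule sum.reindex_bij_witness[of _ "\<lambda>r. r - j" "\<lambda>r. r + j"])
          (use that in \<open>auto simp: add.commute\<close>)
      also have "\<dots> = (\<Sum>r\<in>{j..?N}. emb_poly (if j \<le> r then ?g j * cser C (Suc k - j) q (r - j) else 0) * e (?N - r))"
        by (rule sum.cong) auto
      also have "\<dots> = (\<Sum>r\<le>?N. emb_poly (if j \<le> r then ?g j * cser C (Suc k - j) q (r - j) else 0) * e (?N - r))"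
        by (rule sum.mono_neutral_left) (auto simp: map_zero)
      finally show ?thesis .
    qed
    have "(\<Sum>j=1..Suc k. emb_poly (?g j) * hcoeff z (xseries (Suc k - j) \<Omega> (cser C (Suc k - j)))) =
        (\<Sum>j=1..Suc k. \<Sum>r\<le>?N.
          emb_poly (if j \<le> r then ?g j * cser C (Suc k - j) q (r - j) else 0) * e (?N - r))"
      by (rule sum.cong[OF refl t3])
    also have "\<dots> = (\<Sum>r\<le>?N. emb_poly (\<Sum>j=1..Suc k.
          if j \<le> r then ?g j * cser C (Suc k - j) q (r - j) else 0) * e (?N - r))"
      unfolding map_sum sum_distrib_right by (rule sum.swap)
    finally have t4: "(\<Sum>j=1..Suc k. emb_poly (?g j) * hcoeff z (xseries (Suc k - j) \<Omega> (cser C (Suc k - j)))) = \<dots>" .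
    have "emb_poly (?g 0) * hcoeff z (xseries (Suc k) \<Omega> (cser C (Suc k))) =
        (\<Sum>r\<le>?N. emb_poly (?g 0 * cser C (Suc k) q r) * e (?N - r))"
      by (simp only: pos sum_distrib_left map_mult mult.assoc)
    then show "emb_poly (?g 0) * hcoeff z (xseries (Suc k) \<Omega> (cser C (Suc k))) =
      fps_const [:[:0, 1:]:] * hcoeff z (xseries k \<Omega> (cser C k)) -
      theta (hcoeff (z + 1) (xseries k \<Omega> (cser C k))) -
      (\<Sum>j=1..Suc k. emb_poly (?g j) * hcoeff z (xseries (Suc k - j) \<Omega> (cser C (Suc k - j))))"
      unfolding t1 t2 t4 gfac_mult_cser_Suc
      by (simp only: map_diff left_diff_distrib sum_subtractf)
  qed
qed

text \<open>The relation enters only through height 0. Afterwards both recursions perform the same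
  operations, each compatible with the congruence.\<close>

lemma eq_HG_euler_ext:
  fixes C :: "nat \<Rightarrow> nat \<Rightarrow> ('n::{finite,linorder}) mpoly fps"
  assumes C: "\<And>q r. r > q \<Longrightarrow> C q r = 0"
    and "eq_HG (hg P) (xseries 0 \<Omega> C)"
  shows "eq_HG (hg (euler_ext C P k)) (xseries k \<Omega> (cser C k))"
proof (induction k rule: less_induct)
  case (less k)
  interpret ring_map "emb_laurent :: 'n mpoly fps \<Rightarrow> _" by (rule ring_map_emb_laurent)
  show ?case
  proof (cases k)
    case (Suc k')
    have "emb_laurent (gfac_inv (cser C k')) * emb_laurent (gfac (cser C k') 0) = 1"
      unfolding map_mult[symmetric] mult.commute[of "gfac_inv _"] gfac_inv by (rule map_one)
    then have "xseries (Suc k') \<Omega> (cser C (Suc k')) = emb_laurent (gfac_inv (cser C k')) *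
       (emb_laurent (gfac (cser C k') 0) * xseries (Suc k') \<Omega> (cser C (Suc k')))"
      by (simp only: mult.assoc[symmetric] mult_1_left)
    also have "emb_laurent (gfac (cser C k') 0) * xseries (Suc k') \<Omega> (cser C (Suc k')) =
        hbar_theta (xseries k' \<Omega> (cser C k')) - (\<Sum>j=1..Suc k'.
          emb_laurent (gfac (cser C k') j) * xseries (Suc k' - j) \<Omega> (cser C (Suc k' - j)))"
      by (rule xseries_cser_Suc) (rule C)
    finally have x: "xseries (Suc k') \<Omega> (cser C (Suc k')) = emb_laurent (gfac_inv (cser C k')) *
       (hbar_theta (xseries k' \<Omega> (cser C k')) - (\<Sum>j=1..Suc k'.
          emb_laurent (gfac (cser C k') j) * xseries (Suc k' - j) \<Omega> (cser C (Suc k' - j))))" .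
    show ?thesis
      unfolding Suc x euler_ext.simps hg_mult_data hg_diff_sum hg_theta_data
      by (intro eq_HG_mult eq_HG_diff eq_HG_sum eq_HG_hbar_theta less.IH) (auto simp: Suc)
  qed (use assms in simp)
qed

lemma linked_euler_ext:
  assumes "linked \<Omega> A P"
  shows "linked \<Omega> A (euler_ext C P k)"
proof (induction k rule: less_induct)
  case (less k)
  show ?case
  proof (cases k)
    case (Suc k')
    show ?thesis
      unfolding Suc euler_ext.simps
      by (intro linked_mult_data linked_diff_sum linked_theta_data less.IH) (auto simp: Suc)
  qed (use assms in simp)
qed

lemma mult_data_0: "mult_data f Q 0 = [:[:to_RT (fps_nth f 0):]:] * Q 0"
  by (simp add: mult_data_def)

text \<open>In degree 0 the subtracted terms vanish since g_j has no constant term for j > 0,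
  \<open>theta_data\<close> multiplies by kappa, and the inverse of g_0 contributes 1.\<close>

lemma euler_ext_0: "euler_ext C P k 0 = [:0, 1:] ^ k * P 0"
proof (induction k)
  case (Suc k)
  interpret ring_map "to_RT :: 'a mpoly \<Rightarrow> _" by (rule ring_map_to_RT)
  have "(\<Sum>j=1..Suc k. mult_data (gfac (cser C k) j) (euler_ext C P (Suc k - j)) 0) = 0"
    by (intro sum.neutral ballI) (simp add: mult_data_0 gfac_nth_0 map_zero)
  then show ?case
    unfolding euler_ext.simps mult_data_0[of "gfac_inv _"]
    by (simp add: gfac_inv_nth_0 map_one theta_data_def Suc del: sum.cl_ivl_Suc flip: one_pCons)
qed simp


section \<open>Expanding the exponential\<close>

lemma symmetric_of_degree_collect:
  assumes "\<And>d q r. d \<ge> 1 \<Longrightarrow> q \<ge> 1 \<Longrightarrow> r \<le> q + k \<Longrightarrow> symmetric_of_degree r (c d q r)"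
  shows "symmetric_of_degree r (coeff (fps_nth (collect k c q r) d) a)"
  unfolding collect_def fps_nth_Abs_fps using assms
  by (auto simp: coeff_sum intro!: symmetric_of_degree_sum symmetric_of_degree_mconst
      symmetric_of_degree_mconst_mult)

lemma monom_mult_const: "monom x m * [:y:] = monom (x * y :: 'a::comm_ring_1) m"
  by (simp add: mult.commute[of "monom _ _"] smult_monom mult.commute)

lemma monom_monom_mult:
  "monom (monom a m) m * ([:[:b:]:] * [:f * [:0, 1:] ^ j:]) =
    (monom [:a * b:] m * [:f * [:0, 1:] ^ (m + j):] :: 'a::comm_ring_1 poly poly)"
proof -
  have "monom a m * ([:b:] * (f * [:0, 1:] ^ j)) = [:a * b:] * (f * [:0, 1:] ^ (m + j))"
    by (simp add: monom_altdef power_add mult_ac)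
  moreover have "[:x:] * [:y:] = [:x * y:]" for x y :: "'a poly"
    by simp
  ultimately show ?thesis
    by (simp only: monom_mult_const)
qed

text \<open>Cauchy product in hbar^-1: the term of index m of the exponential raises the power of p
  by m, giving exponent k + q - r again. No relation on p is used.\<close>

lemma exp_pt_hseries:
  "fps_const exp_pt * hseries k \<Omega> (\<lambda>d q r. if d = 0 then 0 else [:c d q r:]) =
    hseries k \<Omega> (\<lambda>d q r. fps_nth (collect k c q r) d)"
proof (rule fps_ext)
  fix d
  interpret T: ring_map "to_RT :: 'a mpoly \<Rightarrow> _" by (rule ring_map_to_RT)
  interpret M: ring_map "map_poly (\<lambda>a :: 'a mpoly. [:to_RT a:])"
    by (intro ring_map_map_poly ring_map_comp[OF ring_map_const_poly] ring_map_to_RT)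
  let ?T = "map_poly (\<lambda>a :: 'a mpoly. [:to_RT a:])"
  let ?p = "[:0, 1:] :: 'a RT poly"
  define e :: "nat \<Rightarrow> 'a mpoly" where "e m = mconst ((-1) ^ m / fact m)" for m
  define E where "E = (\<lambda>m. monom (monom (to_RT (e m)) m) m)"
  have Tm: "?T (monom a m) = monom [:to_RT a:] m" for a m
    by (simp add: map_poly_monom T.map_zero)
  have T0: "?T [:a:] = [:[:to_RT a:]:]" for a
    using Tm[of a 0] by (simp add: monom_0)
  define h where "h = (\<lambda>q. if q = 0 then (if d = 0 then [:\<Omega> * ?p ^ k:] else 0)
     else (\<Sum>r\<le>q + k. ?T (if d = 0 then 0 else [:c d q r:]) * [:\<Omega> * ?p ^ (k + q - r):]))"
  define H where "H = (\<lambda>q. if q = 0 then (if d = 0 then [:\<Omega> * ?p ^ k:] else 0)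
     else (\<Sum>r\<le>q + k. ?T (fps_nth (collect k c q r) d) * [:\<Omega> * ?p ^ (k + q - r):]))"
  have "(\<Sum>m\<le>q. E m * h (q - m)) = H q" for q
  proof (cases "d = 0")
    case True
    \<comment> \<open>For d = 0 the second factor is only its leading term, so just m = q
      survives.\<close>
    have "(\<Sum>m\<le>q. E m * h (q - m)) = (\<Sum>m\<in>{q}. E m * h (q - m))"
      by (rule sum.mono_neutral_right) (auto simp: h_def True M.map_zero)
    also have "\<dots> = E q * [:\<Omega> * ?p ^ k:]"
      by (simp add: h_def True)
    also have "\<dots> = monom [:to_RT (e q):] q * [:\<Omega> * ?p ^ (k + q):]"
      using monom_monom_mult[of "to_RT (e q)" q 1 \<Omega> k] by (simp add: E_def add.commute flip: one_pCons)
    also have "\<dots> = H q"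
    proof (cases "q = 0")
      case True
      then show ?thesis
        using \<open>d = 0\<close> by (simp add: H_def e_def mconst_1 T.map_one monom_0)
    next
      case False
      have "H q = (\<Sum>r\<in>{0}. ?T (fps_nth (collect k c q r) d) * [:\<Omega> * ?p ^ (k + q - r):])"
        unfolding H_def using False
        by (simp only: if_False, intro sum.mono_neutral_right) (auto simp: collect_def True M.map_zero)
      then show ?thesis by (simp add: collect_def True Tm e_def)
    qed
    finally show ?thesis .
  next
    case False
    \<comment> \<open>For d > 0 the leading term is absent, which removes m = q.\<close>
    have "(\<Sum>m\<le>q. E m * h (q - m)) = (\<Sum>m<q. E m * h (q - m))"
      by (rule sum.mono_neutral_right) (auto simp: h_def False)
    also have "\<dots> = (\<Sum>m<q. \<Sum>r\<le>q - m + k. ?T (monom (e m * c d (q - m) r) m) * [:\<Omega> * ?p ^ (k + q - r):])"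
    proof (rule sum.cong[OF refl])
      fix m assume m: "m \<in> {..<q}"
      have "E m * (?T [:c d (q - m) r:] * [:\<Omega> * ?p ^ (k + (q - m) - r):]) =
          ?T (monom (e m * c d (q - m) r) m) * [:\<Omega> * ?p ^ (k + q - r):]" if "r \<le> q - m + k" for r
      proof -
        have *: "m + (k + (q - m) - r) = k + q - r" using m that by auto
        show ?thesis
          unfolding E_def T0 monom_monom_mult Tm T.map_mult * ..
      qed
      then show "E m * h (q - m) = (\<Sum>r\<le>q - m + k. ?T (monom (e m * c d (q - m) r) m) * [:\<Omega> * ?p ^ (k + q - r):])"
        using m False by (simp add: h_def sum_distrib_left)
    qed
    also have "\<dots> = (\<Sum>m<q. \<Sum>r | r \<in> {..q + k} \<and> r \<le> q - m + k. ?T (monom (e m * c d (q - m) r) m) * [:\<Omega> * ?p ^ (k + q - r):])"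
      by (intro sum.cong) auto
    \<comment> \<open>Exchanging the sums leaves exactly the index condition built into
      \<open>collect\<close>.\<close>
    also have "\<dots> = (\<Sum>r\<le>q + k. \<Sum>m | m \<in> {..<q} \<and> r \<le> q - m + k. ?T (monom (e m * c d (q - m) r) m) * [:\<Omega> * ?p ^ (k + q - r):])"
      by (rule sum.swap_restrict) auto
    also have "\<dots> = H q"
      unfolding H_def using False
      by (auto simp: collect_def M.map_sum sum_distrib_right e_def simp del: mult_pCons_right
        intro!: sum.cong)
    finally show ?thesis .
  qed
  then have "Abs_fps E * Abs_fps h = Abs_fps H"
    by (simp add: fps_eq_iff fps_mult_nth atMost_atLeast0)
  then have "fps_to_fls (Abs_fps E) * fps_to_fls (Abs_fps h) = fps_to_fls (Abs_fps H)"
    by (simp flip: fls_times_fps_to_fls)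
  then show "fps_nth (fps_const exp_pt * hseries k \<Omega> (\<lambda>d q r. if d = 0 then 0 else [:c d q r:])) d =
      fps_nth (hseries k \<Omega> (\<lambda>d q r. fps_nth (collect k c q r) d)) d"
    unfolding fps_mult_left_const_nth hseries_def exp_pt_def fps_nth_Abs_fps
    by (simp only: E_def e_def h_def H_def)
qed

lemma minus_one_power_fps_nth: "fps_nth ((-1) ^ q * f) d = (-1) ^ q * fps_nth (f :: 'a::comm_ring_1 fps) d"
  by (cases "even q") auto

lemma minus_one_power_cancel: "(-1) ^ q * ((-1) ^ q * f) = (f :: 'a::comm_ring_1)"
  by (cases "even q") auto

lemma has_expansion_collect:
  assumes sym: "\<And>d q r. symmetric_of_degree r (c d q r)"
    and "eq_HG (HG Q) (fps_const exp_pt * hseries k \<Omega> (\<lambda>d q r. if d = 0 then 0 else [:c d q r:]))"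
  shows "has_expansion k \<Omega> Q (\<lambda>q r. (-1) ^ q * collect k c q r)"
  unfolding has_expansion_def
proof (intro conjI allI impI exI[of _ c])
  show "symmetric_of_degree r (coeff (fps_nth ((-1) ^ q * collect k c q r) d) a)" for q r d a
    using symmetric_of_degree_collect[of k c r q d a, OF sym]
    by (cases "even q") (auto intro: symmetric_of_degree_uminus)
  show "eq_HG (HG Q) (hseries k \<Omega> (\<lambda>d q r. (-1) ^ q * fps_nth ((-1) ^ q * collect k c q r) d))"
    using assms(2) unfolding exp_pt_hseries minus_one_power_fps_nth minus_one_power_cancel .
qed (use assms in \<open>auto simp: minus_one_power_cancel\<close>)

definition exp_term :: "nat \<Rightarrow> ('n::{finite,linorder}) tfun" where
  "exp_term m = fps_const (monom (mconst ((-1) ^ m / fact m)) m)"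

definition lift_t :: "('n::{finite,linorder}) mpoly fps \<Rightarrow> 'n tfun" where
  "lift_t f = Abs_fps (\<lambda>d. [:fps_nth f d:])"

lemma ring_map_lift_t: "ring_map (lift_t :: ('n::{finite,linorder}) mpoly fps \<Rightarrow> _)"
  unfolding lift_t_def by (intro ring_map_fps ring_map_const_poly)

text \<open>For r = 0 the constraint on r in \<open>collect\<close> is void. The first summand pairs
  the exponential with the leading 1; vanishing constant terms of \<open>C\<close> make the rest
  correct at d = 0.\<close>

lemma collect_eq:
  assumes "\<And>q r. fps_nth (C q r) 0 = 0"
  shows "collect k (\<lambda>d q r. fps_nth (C q r) d) q 0 =
    exp_term q + (\<Sum>m<q. exp_term m * lift_t (C (q - m) 0))"
  using assms
  by (intro fps_ext) (auto simp: collect_def exp_term_def lift_t_def fps_sum_nth lessThan_def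
      smult_monom mult.commute[of "monom _ _"] mult.commute[of "mconst _"])

section \<open>The t-derivative of the collected coefficients\<close>

lemma ddt_add: "ddt (f + g) = ddt f + ddt g"
  by (rule fps_ext) (simp add: ddt_def pderiv_add ring_distribs)

lemma ddt_uminus: "ddt (- f) = - ddt f"
  by (rule fps_ext) (simp add: ddt_def pderiv_minus)

lemma ddt_0 [simp]: "ddt 0 = 0"
  by (rule fps_ext) (simp add: ddt_def)

lemma ddt_sum: "ddt (\<Sum>x\<in>S. f x) = (\<Sum>x\<in>S. ddt (f x))"
  by (induction S rule: infinite_finite_induct) (simp_all add: ddt_add)

lemma ring_map_mconst: "ring_map (mconst :: complex \<Rightarrow> 'n::linorder mpoly)"
  by unfold_locales (simp_all add: mconst_def mult_single single_add)

text \<open>Product rule: t-differentiation sends (-t)^m/m! to minus its predecessor, and on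
  x-series the derivative is \<open>theta\<close>.\<close>

lemma ddt_exp_term_mult:
  "ddt (exp_term m * lift_t f) = exp_term m * lift_t (theta f) -
     (case m of 0 \<Rightarrow> 0 | Suc m' \<Rightarrow> exp_term m' * lift_t f)"
proof (rule fps_ext)
  fix d
  interpret ring_map "mconst :: complex \<Rightarrow> 'a mpoly" by (rule ring_map_mconst)
  let ?e = "\<lambda>m. mconst ((-1) ^ m / fact m) :: 'a mpoly"
  have e: "of_nat (Suc m') * ?e (Suc m') = - ?e m'" for m'
    unfolding map_of_nat[symmetric] map_mult[symmetric] map_uminus[symmetric]
    by (simp add: field_simps del: of_nat_Suc)
  have n: "fps_nth (exp_term m * lift_t g) d = monom (?e m * fps_nth g d) m" for m g
    by (simp add: exp_term_def lift_t_def smult_monom mult.commute[of "monom _ _"]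
        mult.commute[of "mconst _"])
  have "pderiv (monom (?e m * fps_nth f d) m) =
      - (case m of 0 \<Rightarrow> 0 | Suc m' \<Rightarrow> monom (?e m' * fps_nth f d) m')"
  proof (cases m)
    case (Suc m')
    show ?thesis
      unfolding Suc pderiv_monom mult.assoc[symmetric] e by (simp add: minus_monom)
  qed (simp add: pderiv_monom)
  moreover have "of_nat d * monom (?e m * fps_nth f d) m = monom (?e m * fps_nth (theta f) d) m"
    by (simp add: of_nat_poly smult_monom mult.left_commute)
  ultimately show "fps_nth (ddt (exp_term m * lift_t f)) d = fps_nth (exp_term m * lift_t (theta f) -
     (case m of 0 \<Rightarrow> 0 | Suc m' \<Rightarrow> exp_term m' * lift_t f)) d"
    unfolding ddt_def fps_nth_Abs_fps n fps_sub_nth by (simp add: n split: nat.split)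
qed

lemma exp_term_0: "exp_term 0 = 1"
  by (simp add: exp_term_def mconst_1 monom_0)

text \<open>This is the recursion for y^0. The subtracted terms of \<open>cser\<close> need
  \<open>j \<le> r\<close>, so for r = 0 only the derivative and the division by g_0 remain.\<close>

lemma ddt_collect:
  fixes C :: "nat \<Rightarrow> nat \<Rightarrow> ('n::{finite,linorder}) mpoly fps"
  assumes C: "\<And>q r. fps_nth (C q r) 0 = 0"
  shows "ddt (collect k (\<lambda>d q r. fps_nth (cser C k q r) d) (Suc q) 0) =
    - (lift_t (gfac (cser C k) 0) * collect (Suc k) (\<lambda>d q r. fps_nth (cser C (Suc k) q r) d) q 0)"
proof -
  interpret ring_map "lift_t :: 'n mpoly fps \<Rightarrow> _" by (rule ring_map_lift_t)
  let ?C = "\<lambda>q. cser C k q 0"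
  \<comment> \<open>The product rule with the constant series 1 differentiates the exponential term
    alone.\<close>
  have "ddt (exp_term (Suc q) * lift_t 1) = - (exp_term q :: 'n tfun)"
    unfolding ddt_exp_term_mult fps_const_1_eq_1[symmetric] theta_const
    by (simp add: map_zero map_one)
  then have 1: "ddt (exp_term (Suc q)) = - (exp_term q :: 'n tfun)"
    by (simp add: map_one)
  have "(\<Sum>m<Suc q. case m of 0 \<Rightarrow> 0 | Suc m' \<Rightarrow> exp_term m' * lift_t (?C (Suc q - m))) =
      (\<Sum>m<q. exp_term m * lift_t (?C (q - m)))"
    unfolding sum.lessThan_Suc_shift by simp
  then have "(\<Sum>m<Suc q. ddt (exp_term m * lift_t (?C (Suc q - m)))) =
      (\<Sum>m<Suc q. exp_term m * lift_t (theta (?C (Suc q - m)))) -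
      (\<Sum>m<q. exp_term m * lift_t (?C (q - m)))"
    unfolding ddt_exp_term_mult sum_subtractf by simp
  also have "(\<Sum>m<Suc q. exp_term m * lift_t (theta (?C (Suc q - m)))) =
      exp_term q * lift_t (theta (?C 1)) + (\<Sum>m<q. exp_term m * lift_t (theta (?C (Suc (q - m)))))"
    by (simp add: Suc_diff_le)
  finally have 2: "(\<Sum>m<Suc q. ddt (exp_term m * lift_t (?C (Suc q - m)))) =
      exp_term q * lift_t (theta (?C 1)) -
      (\<Sum>m<q. exp_term m * lift_t (?C (q - m) - theta (?C (Suc (q - m)))))"
    by (simp add: map_diff right_diff_distrib sum_subtractf)
  have g: "gfac (cser C k) 0 * cser C (Suc k) m 0 = ?C m - theta (?C (Suc m))" for m
    by (simp add: gfac_mult_cser_Suc)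
  show ?thesis
    unfolding collect_eq[of "cser C k", OF cser_nth_0[OF C]] collect_eq[of "cser C (Suc k)", OF cser_nth_0[OF C]]
      ddt_add ddt_sum 1 2 distrib_left sum_distrib_left
    unfolding mult.left_commute[of "lift_t _" "exp_term _"] map_mult[symmetric] g
    by (simp add: gfac_def map_diff map_one algebra_simps)
qed


theorem theorem4p5:
  fixes \<Omega> :: "('n::{finite,linorder}) RT poly"
    and P0 :: "nat \<Rightarrow> 'n RT poly poly"
    and y0 :: "nat \<Rightarrow> nat \<Rightarrow> 'n tfun"
  assumes "invertible_class \<Omega>"
    and "euler_data \<Omega> P0"
    and "has_expansion 0 \<Omega> P0 y0"
  shows "\<exists>(P :: nat \<Rightarrow> nat \<Rightarrow> 'n RT poly poly) (y :: nat \<Rightarrow> nat \<Rightarrow> nat \<Rightarrow> 'n tfun).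
           linked_euler_data \<Omega> P \<and>
           (\<forall>d. eq_N d (P d 0) (P0 d)) \<and>
           y 0 = y0 \<and>
           (\<forall>k. has_expansion k \<Omega> (\<lambda>d. P d k) (y k)) \<and>
           (\<forall>i\<ge>1. \<forall>q\<ge>1.
              ddt (y (i - 1) 1 0) dvd 1 \<and>
              y i q 0 * ddt (y (i - 1) 1 0) = ddt (y (i - 1) (q + 1) 0))"
proof -
  obtain c where sym: "\<And>d q r. d \<ge> 1 \<Longrightarrow> q \<ge> 1 \<Longrightarrow> r \<le> q \<Longrightarrow> symmetric_of_degree r (c d q r)"
    and HG: "eq_HG (HG P0) (fps_const exp_pt * hseries 0 \<Omega> (\<lambda>d q r. if d = 0 then 0 else [:c d q r:]))"
    and y0: "\<And>q r. q \<ge> 1 \<Longrightarrow> r \<le> q \<Longrightarrow> (-1) ^ q * y0 q r = collect 0 c q r"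
    using assms(3) unfolding has_expansion_def add_0_right
    by (elim conjE exE) (rule that; simp only:)
  \<comment> \<open>Nothing is known of \<open>c\<close> outside the stated range; cutting it off
    there gives the vanishing and symmetry needed by the recursion.\<close>
  define C :: "nat \<Rightarrow> nat \<Rightarrow> 'n mpoly fps" where
    "C q r = Abs_fps (\<lambda>d. if d \<ge> 1 \<and> q \<ge> 1 \<and> r \<le> q then c d q r else 0)" for q r
  have C0: "fps_nth (C q r) 0 = 0" for q r by (simp add: C_def)
  have Cz: "C q r = 0" if "r > q" for q r
    using that by (intro fps_ext) (simp add: C_def)
  have Cs: "sym_fps r (C q r)" for q r
    using sym by (auto simp: C_def sym_fps_def)
  define P where "P d k = euler_ext C P0 k d" for d k
  define cs where "cs k d q r = fps_nth (cser C k q r) d" for k d q r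
  \<comment> \<open>Height 0 must be \<open>y0\<close> itself, whose values outside the expansion
    range are not determined by \<open>c\<close>.\<close>
  define y where "y k q r = (if k = 0 then y0 q r else (-1) ^ q * collect k (cs k) q r)" for k q r

  have xs: "hseries k \<Omega> (\<lambda>d q r. if d = 0 then 0 else [:cs k d q r:]) = xseries k \<Omega> (cser C k)" for k
    unfolding xseries_def by (rule hseries_cong) (simp add: cs_def cser_nth_0[OF C0])
  have "hseries 0 \<Omega> (\<lambda>d q r. if d = 0 then 0 else [:c d q r:]) = xseries 0 \<Omega> C"
    unfolding xseries_def by (rule hseries_cong) (simp add: C_def)
  with HG have "eq_HG (hg P0) (xseries 0 \<Omega> C)"
    unfolding HG_eq by (metis eq_HG_exp_pt_cancel)
  then have hg: "eq_HG (hg (euler_ext C P0 k)) (xseries k \<Omega> (cser C k))" for k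
    by (intro eq_HG_euler_ext Cz)
  have exp: "has_expansion k \<Omega> (\<lambda>d. P d k) (y k)" for k
  proof (cases "k = 0")
    case True
    then show ?thesis using assms(3) by (simp add: P_def y_def[abs_def])
  next
    case False
    have "symmetric_of_degree r (cs k d q r)" for d q r
      using sym_fps_cser[OF Cs, where q = q and r = r and k = k]
      by (simp add: cs_def sym_fps_def)
    moreover have "eq_HG (HG (\<lambda>d. P d k))
        (fps_const exp_pt * hseries k \<Omega> (\<lambda>d q r. if d = 0 then 0 else [:cs k d q r:]))"
      unfolding HG_eq xs P_def using eq_HG_mult[OF hg[of k]] by simp
    ultimately have "has_expansion k \<Omega> (\<lambda>d. P d k) (\<lambda>q r. (-1) ^ q * collect k (cs k) q r)"
      by (rule has_expansion_collect)
    then show ?thesis using False by (simp add: y_def[abs_def])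
  qed

  have linked: "linked \<Omega> P0 (euler_ext C P0 k)" for k
    using assms(2) unfolding euler_data_def by (intro linked_euler_ext, unfold linked_def) (rule conjunct2)
  have "eq_N 0 (P 0 k) ([:0, 1:] ^ k * to_N0 \<Omega>)" for k
    using assms(2) unfolding P_def euler_ext_0 euler_data_def eq_N_def
    by (simp only: dvd_mult flip: right_diff_distrib)
  with linked have lk: "linked_euler_data \<Omega> P"
    unfolding linked_euler_data_def linked_def P_def by simp

  have coll: "collect 0 c q 0 = collect 0 (cs 0) q 0" if "q \<ge> 1" for q
    by (rule fps_ext) (auto simp: collect_def cs_def C_def intro!: sum.cong)
  have y: "y k q 0 = (-1) ^ q * collect k (cs k) q 0" if "q \<ge> 1" for k q
    using y0[OF that, of 0] minus_one_power_cancel[of q "y0 q 0"] coll[OF that]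
    by (simp add: y_def)
  let ?g = "\<lambda>k. lift_t (gfac (cser C k) 0)"
  have ddt_c: "ddt (collect k (cs k) (Suc q) 0) = - (?g k * collect (Suc k) (cs (Suc k)) q 0)" for k q
    unfolding cs_def[abs_def] by (rule ddt_collect[OF C0])
  have ddt_y: "ddt (y k (Suc q) 0) = (-1) ^ q * (?g k * collect (Suc k) (cs (Suc k)) q 0)" for k q
    by (cases "even q") (simp_all add: y ddt_c ddt_uminus)
  \<comment> \<open>For q = 0 the collected coefficient is 1, so this derivative is g_0 exactly:
    free of t, and a unit because g_0 is.\<close>
  have ddt_y1: "ddt (y k 1 0) = ?g k" for k
  proof -
    have "collect (Suc k) (cs (Suc k)) 0 0 = 1"
      unfolding cs_def[abs_def] by (subst collect_eq) (simp_all add: cser_nth_0[OF C0] exp_term_0)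
    then show ?thesis using ddt_y[of k 0] by simp
  qed
  interpret ring_map "lift_t :: 'n mpoly fps \<Rightarrow> _" by (rule ring_map_lift_t)
  have "ddt (y k 1 0) dvd 1" for k
    unfolding ddt_y1 by (rule dvdI[of _ _ "lift_t (gfac_inv (cser C k))"])
      (simp only: gfac_inv map_one flip: map_mult)
  moreover have "y (Suc k) q 0 * ddt (y k 1 0) = ddt (y k (Suc q) 0)" if "q \<ge> 1" for k q
    unfolding ddt_y1 ddt_y y[OF that] by (simp only: mult_ac)
  ultimately have "\<forall>i\<ge>1. \<forall>q\<ge>1. ddt (y (i - 1) 1 0) dvd 1 \<and>
      y i q 0 * ddt (y (i - 1) 1 0) = ddt (y (i - 1) (q + 1) 0)"
    by (auto simp: Suc_le_eq gr0_conv_Suc)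
  moreover have "\<forall>d. eq_N d (P d 0) (P0 d)"
    by (simp add: P_def eq_N_def)
  moreover have "y 0 = y0"
    by (simp add: y_def[abs_def])
  ultimately show ?thesis using lk exp by blast
qed

end
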